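(* Let $\mathfrak{X}=(X,\{R_{i}\}_{i=0}^{d})$ be a commutative association scheme (with $d\ge 2$) which is generated by a non-symmetric relation $R_{1}$ and satisfies \[R_{1}^{2}\subseteq\{R_{1},R_{1^{*}},R_{2}\},\qquad R_{1}R_{1^{*}}\subseteq\{R_{0},R_{1},R_{1^{*}},R_{2},R_{2^{*}}\},\qquad 2\notin\{1^{*},2^{*}\}.\] If $k_{1}=k_{2}>1$, then $d=4$. Moreover, if in addition $\mathfrak{X}$ is pseudocyclic, then $\mathfrak{X}$ is isomorphic to the cyclotomic scheme $\mathrm{Cyc}(13,4)$.
   Context: A $d$-class association scheme is a pair $(X,\{R_i\}_{i=0}^d)$ with $X$ finite and nonempty relations $R_i\subseteq X\times X$ such that: $R_0=\{(x,x)\mid x\in X\}$; the $R_i$ partition $X\times X$; for each $i$ there is $i^*$ with $R_i^T:=\{(y,x)\mid (x,y)\in R_i\}=R_{i^*}$; and for all $i,j,l$ the number $|R_i(x)\cap R_{j^*}(y)|$ is a constant $p^l_{i,j}$ for all $(x,y)\in R_l$, where $R(x)=\{y\mid (x,y)\in R\}$. The valency of $R_i$ is $k_i=p^0_{i,i^*}$. $R_i$ is symmetric if $i=i^*$, non-symmetric otherwise. The scheme is commutative if $p^l_{i,j}=p^l_{j,i}$ for all $i,j,l$. For nonempty subsets $E,F$ of $\{R_i\}$, $EF:=\{R_l\mid \sum_{R_i\in E}\sum_{R_j\in F}p^l_{i,j}\ne 0\}$; write $R_iR_j$ for $\{R_i\}\{R_j\}$ and $R_i^2$ for $R_iR_i$.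 A subset $F$ is closed if $R_{i^*}R_j\subseteq F$ for all $R_i,R_j\in F$; $R_j$ generates $\mathfrak{X}$ if the smallest closed subset containing $R_j$ is all of $\{R_i\}_{i=0}^d$. For a commutative scheme, the Bose–Mesner algebra (spanned by the adjacency matrices $A_i$ of the $R_i$) has a basis of primitive idempotents $E_0=J/|X|,E_1,\dots,E_d$; the multiplicities are $m_i=\operatorname{rank}E_i$, and the scheme is pseudocyclic if $m_1=\dots=m_d$. For a prime power $q$, a primitive element $\alpha$ of $\mathrm{GF}(q)$ and a divisor $d$ of $q-1$, the cyclotomic scheme $\mathrm{Cyc}(q,d)$ has point set $\mathrm{GF}(q)$, $R_0$ the diagonal, and $(x,y)\in R_i$ iff $x-y\in\alpha^i\langle\alpha^d\rangle$ for $1\le i\le d$. Two schemes are isomorphic if there is a bijection between point sets mapping each relation of one onto a relation of the other. *)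

theory Defs
  imports "HOL-Analysis.Analysis"
begin

text \<open>
  The finite point set of a scheme is a type of class \<open>finite\<close>. A family of relations is given by
  \<open>d\<close> and \<open>R :: nat \<Rightarrow> 'a rel\<close>, of which only \<open>R 0, \<dots>, R d\<close> matter. These are nonempty and pairwise
  disjoint, hence distinct, so sets of relations are represented by sets of indices below.
\<close>

definition transp_idx :: "nat \<Rightarrow> (nat \<Rightarrow> 'a rel) \<Rightarrow> nat \<Rightarrow> nat" where
  "transp_idx d R i = (THE j. j \<le> d \<and> (R i)\<inverse> = R j)"

definition int_count :: "nat \<Rightarrow> (nat \<Rightarrow> 'a rel) \<Rightarrow> nat \<Rightarrow> nat \<Rightarrow> 'a \<Rightarrow> 'a \<Rightarrow> nat" where
  "int_count d R i j x y = card (R i `` {x} \<inter> R (transp_idx d R j) `` {y})"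

definition association_scheme :: "nat \<Rightarrow> (nat \<Rightarrow> 'a::finite rel) \<Rightarrow> bool" where
  "association_scheme d R \<longleftrightarrow>
     (\<forall>i\<le>d. R i \<noteq> {}) \<and>
     R 0 = Id \<and>
     (\<Union>i\<le>d. R i) = UNIV \<and> disjoint_family_on R {..d} \<and>
     (\<forall>i\<le>d. \<exists>j\<le>d. (R i)\<inverse> = R j) \<and>
     (\<forall>i\<le>d. \<forall>j\<le>d. \<forall>l\<le>d. \<exists>n. \<forall>(x, y)\<in>R l. int_count d R i j x y = n)"

text \<open>\<open>int_num d R i j l\<close> is the intersection number with lower indices \<open>i\<close>, \<open>j\<close> and upper index \<open>l\<close>.\<close>

definition int_num :: "nat \<Rightarrow> (nat \<Rightarrow> 'a::finite rel) \<Rightarrow> nat \<Rightarrow> nat \<Rightarrow> nat \<Rightarrow> nat" where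
  "int_num d R i j l = (THE n. \<forall>(x, y)\<in>R l. int_count d R i j x y = n)"

definition valency :: "nat \<Rightarrow> (nat \<Rightarrow> 'a::finite rel) \<Rightarrow> nat \<Rightarrow> nat" where
  "valency d R i = int_num d R i (transp_idx d R i) 0"

definition symmetric_rel :: "nat \<Rightarrow> (nat \<Rightarrow> 'a rel) \<Rightarrow> nat \<Rightarrow> bool" where
  "symmetric_rel d R i \<longleftrightarrow> transp_idx d R i = i"

definition commutative_scheme :: "nat \<Rightarrow> (nat \<Rightarrow> 'a::finite rel) \<Rightarrow> bool" where
  "commutative_scheme d R \<longleftrightarrow>
     association_scheme d R \<and>
     (\<forall>i\<le>d. \<forall>j\<le>d. \<forall>l\<le>d. int_num d R i j l = int_num d R j i l)"

definition complex_prod :: "nat \<Rightarrow> (nat \<Rightarrow> 'a::finite rel) \<Rightarrow> nat set \<Rightarrow> nat set \<Rightarrow> nat set" where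
  "complex_prod d R E F = {l. l \<le> d \<and> (\<Sum>i\<in>E. \<Sum>j\<in>F. int_num d R i j l) \<noteq> 0}"

definition closed_subset :: "nat \<Rightarrow> (nat \<Rightarrow> 'a::finite rel) \<Rightarrow> nat set \<Rightarrow> bool" where
  "closed_subset d R F \<longleftrightarrow>
     F \<noteq> {} \<and> F \<subseteq> {..d} \<and>
     (\<forall>i\<in>F. \<forall>j\<in>F. complex_prod d R {transp_idx d R i} {j} \<subseteq> F)"

definition generates :: "nat \<Rightarrow> (nat \<Rightarrow> 'a::finite rel) \<Rightarrow> nat \<Rightarrow> bool" where
  "generates d R j \<longleftrightarrow> \<Inter>{F. closed_subset d R F \<and> j \<in> F} = {..d}"

definition adj_matrix :: "'a rel \<Rightarrow> complex^'a^'a::finite" where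
  "adj_matrix r = (\<chi> x y. if (x, y) \<in> r then 1 else 0)"

text \<open>The complex span of the adjacency matrices, written entrywise because \<open>*s\<close> does not
  scale a matrix by an element of its entry field.\<close>

definition bose_mesner :: "nat \<Rightarrow> (nat \<Rightarrow> 'a::finite rel) \<Rightarrow> (complex^'a^'a) set" where
  "bose_mesner d R = range (\<lambda>c. \<chi> x y. \<Sum>i\<le>d. c i * adj_matrix (R i) $ x $ y)"

definition primitive_idempotent :: "(complex^'a^'a::finite) set \<Rightarrow> complex^'a^'a \<Rightarrow> bool" where
  "primitive_idempotent B E \<longleftrightarrow>
     E \<in> B \<and> E \<noteq> 0 \<and> E ** E = E \<and>
     (\<forall>F\<in>B. F ** F = F \<and> E ** F = F \<and> F ** E = F \<longrightarrow> F = 0 \<or> F = E)"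

definition trivial_idempotent :: "complex^'a^'a::finite" where
  "trivial_idempotent = (\<chi> x y. 1 / of_nat CARD('a))"

definition pseudocyclic :: "nat \<Rightarrow> (nat \<Rightarrow> 'a::finite rel) \<Rightarrow> bool" where
  "pseudocyclic d R \<longleftrightarrow>
     (\<exists>m. \<forall>E. primitive_idempotent (bose_mesner d R) E \<and> E \<noteq> trivial_idempotent \<longrightarrow> rank E = m)"

text \<open>A primitive element of a finite field generates its multiplicative group.\<close>

definition primitive_element :: "'f::{finite,field} \<Rightarrow> bool" where
  "primitive_element \<alpha> \<longleftrightarrow> range (\<lambda>n::int. \<alpha> powi n) = UNIV - {0}"

definition cyclotomic_rel :: "'f::{finite,field} \<Rightarrow> nat \<Rightarrow> nat \<Rightarrow> 'f rel" where
  "cyclotomic_rel \<alpha> d i =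
     (if i = 0 then Id else {(x, y). x - y \<in> range (\<lambda>n::int. \<alpha> ^ i * (\<alpha> ^ d) powi n)})"

definition scheme_iso ::
    "nat \<Rightarrow> (nat \<Rightarrow> 'a rel) \<Rightarrow> nat \<Rightarrow> (nat \<Rightarrow> 'b rel) \<Rightarrow> bool" where
  "scheme_iso d R e S \<longleftrightarrow>
     (\<exists>f :: 'a \<Rightarrow> 'b. bij f \<and>
        (\<forall>i\<le>d. \<exists>j\<le>e. map_prod f f ` R i = S j))"

end

theory Submission
  imports Defs
begin

text \<open>
  Write \<open>A\<close>, \<open>B\<close> for the adjacency matrices of \<open>R 1\<close>, \<open>R 2\<close>. Associativity of \<open>A A A\<^sup>T\<close> together
  with the row sums of the intersection numbers determines the products of \<open>A\<close>, \<open>A\<^sup>T\<close>, \<open>B\<close>, \<open>B\<^sup>T\<close>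
  up to a few parameters and forces their span with the identity to be closed, except for one
  five-class family, whose multiplicities are not integral. Hence \<open>d = 4\<close>.

  For a pseudocyclic scheme, the two nontrivial eigenspaces of \<open>A + A\<^sup>T\<close> consist of one or two
  eigenspaces of the scheme each. An integrality argument shows that they have the same
  dimension, and the trace of \<open>A + A\<^sup>T\<close> then leaves only valency 3 and 13 points. In that
  scheme every arc \<open>(x 0, x 1)\<close> extends uniquely to a walk with \<open>(x i, x (i + 1)) \<in> R 1\<close> and
  \<open>(x i, x (i + 2)) \<in> R 2\<close>. The relation containing \<open>(x i, x (i + j))\<close> depends on \<open>j\<close> only,
  so that \<open>x\<close> enumerates the points like an arithmetic progression in \<open>GF(13)\<close>.
\<close>

subsection \<open>Complex matrices\<close>

text \<open>Products with \<open>R 2\<close> are not restricted by hypothesis, so they may leak into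
  classes other than 0, 1, 2 and the transposes of 1 and 2. Let b, c be the coefficients of A^T, B
  in A^2, and a, f those of A, B in A A^T. The differences s = b - f and t = c - f satisfy s + t = 1
  + a and s t = f a, hence are nonnegative. If t > 0, associativity bounds the coefficient of B in B
  A^T from below by exactly what the row sum permits, so nothing leaks. If t = 0, then a = 0 and s =
  1, and either nothing leaks or the leak has total weight K; the latter is the five-class family.

  In the pseudocyclic case equal dimensions mean that the two eigenvalues of A + A^T add up to -1.
  In terms of s and a this reads s^2 + a^2 = s, which together with f > 0 leaves only a = 0, s = 1.
  Then c = f = 1, and these intersection numbers equal to 1 make the continuation of a walk
  unique.\<close>

lemma trace_idempotent_eq_rank:
  fixes E :: "'a::field^'n::finite^'n"
  assumes "E ** E = E"
  shows "trace E = of_nat (rank E)"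
proof -
  obtain B where B: "B \<subseteq> rows E" "vec.independent B" "rows E \<subseteq> vec.span B"
      "card B = vec.dim (rows E)"
    using vec.basis_exists by blast
  have fB: "finite B" using B(2) vec.finiteI_independent by blast
  define \<phi> where "\<phi> b v = vec.representation B v b" for b v
  have lin: "\<phi> b (\<Sum>x\<in>UNIV. c x *s E $ x) = (\<Sum>x\<in>UNIV. c x * \<phi> b (E $ x))" for b c
  proof -
    have sp: "E $ x \<in> vec.span B" for x
      using B(3) by (force simp: rows_def row_def vec_nth_inverse)
    have "\<phi> b (\<Sum>x\<in>UNIV. c x *s E $ x) = (\<Sum>x\<in>UNIV. \<phi> b (c x *s E $ x))"
      unfolding \<phi>_def
      by (subst vec.representation_sum[OF B(2)]) (auto intro: vec.span_scale sp)
    also have "\<dots> = (\<Sum>x\<in>UNIV. c x * \<phi> b (E $ x))"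
      unfolding \<phi>_def by (simp add: vec.representation_scale[OF B(2) sp])
    finally show ?thesis .
  qed
  have exp: "E $ x = (\<Sum>b\<in>B. \<phi> b (E $ x) *s b)" for x
  proof -
    have "E $ x \<in> vec.span B"
      using B(3) by (force simp: rows_def row_def vec_nth_inverse)
    then show ?thesis
      unfolding \<phi>_def by (rule vec.sum_representation_eq[OF B(2) _ fB order.refl, symmetric])
  qed
  \<comment> \<open>Let C hold the coordinates of the rows of \<open>E\<close> in the basis
    \<open>B\<close>, so that E = C B. As \<open>E\<close> is idempotent it fixes its row space,
    hence B C = 1, and trace (C B) = trace (B C) = card B.\<close>
  have fix_row: "(\<Sum>x\<in>UNIV. b $ x *s E $ x) = b" if b: "b \<in> B" for b
  proof -
    obtain z where z: "b = E $ z"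
      using b B(1) by (force simp: rows_def row_def vec_nth_inverse)
    have "(\<Sum>x\<in>UNIV. b $ x *s E $ x) = (E ** E) $ z"
      by (simp add: z vec_eq_iff matrix_matrix_mult_def)
    then show ?thesis using assms z by simp
  qed
  have "trace E = (\<Sum>x\<in>UNIV. (\<Sum>b\<in>B. \<phi> b (E $ x) *s b) $ x)"
    unfolding trace_def by (simp only: exp[symmetric])
  also have "\<dots> = (\<Sum>b\<in>B. \<Sum>x\<in>UNIV. b $ x * \<phi> b (E $ x))"
    by (subst sum.swap) (simp add: mult.commute)
  also have "\<dots> = (\<Sum>b\<in>B. \<phi> b b)"
    by (intro sum.cong refl) (simp add: lin[symmetric] fix_row)
  also have "\<dots> = (\<Sum>b\<in>B. 1)"
    unfolding \<phi>_def by (intro sum.cong refl) (simp add: vec.representation_basis[OF B(2)])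
  finally show ?thesis using B(4) by (simp add: row_rank_def_gen)
qed

definition cscale :: "complex \<Rightarrow> complex^'n^'n \<Rightarrow> complex^'n^'n" (infixr "*\<^sub>m" 75) where
  "c *\<^sub>m M = (\<chi> x y. c * M $ x $ y)"

lemma cscale_nth [simp]: "(c *\<^sub>m M) $ x $ y = c * M $ x $ y"
  by (simp add: cscale_def)

lemma cscale_simps:
  "(M + N) ** P = M ** P + N ** P" "(M - N) ** P = M ** P - N ** P"
  "P ** (M + N) = P ** M + P ** N" "P ** (M - N) = P ** M - P ** N"
  "(c *\<^sub>m M) ** P = c *\<^sub>m (M ** P)" "P ** (c *\<^sub>m M) = c *\<^sub>m (P ** M)"
  for M N P :: "complex^'n::finite^'n"
  by (simp_all add: vec_eq_iff matrix_matrix_mult_def algebra_simps sum.distrib sum_subtractf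
      sum_distrib_left)

lemma matrix_eqI: "(\<And>x y. M $ x $ y = N $ x $ y) \<Longrightarrow> M = N"
  by (simp add: vec_eq_iff)

lemma cscale_cscale [simp]: "c *\<^sub>m e *\<^sub>m M = (c * e) *\<^sub>m M"
  by (simp add: vec_eq_iff)

lemma trace_simps:
  "trace (M + N) = trace M + trace N" "trace (M - N) = trace M - trace N"
  "trace (c *\<^sub>m M) = c * trace M" "trace (mat 1 :: complex^'n^'n) = of_nat CARD('n)"
  for M N :: "complex^'n::finite^'n"
  by (simp_all add: trace_def sum.distrib sum_subtractf sum_distrib_left mat_def)

definition all_ones :: "complex^'n^'n" where "all_ones = (\<chi> x y. 1)"

subsection \<open>Intersection numbers\<close>

locale commutative_association_scheme =
  fixes d :: nat and R :: "nat \<Rightarrow> 'a::finite rel"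
  assumes commutative_scheme: "commutative_scheme d R"
begin

abbreviation tr where "tr \<equiv> transp_idx d R"
abbreviation p where "p \<equiv> int_num d R"
abbreviation k where "k \<equiv> valency d R"

lemma scheme: "association_scheme d R"
  using commutative_scheme by (simp add: commutative_scheme_def)

lemma R_0: "R 0 = Id"
  using scheme by (simp add: association_scheme_def)

lemma R_nonempty: "i \<le> d \<Longrightarrow> \<exists>x y. (x, y) \<in> R i"
proof -
  assume "i \<le> d"
  then have "R i \<noteq> {}" using scheme by (simp add: association_scheme_def)
  then show ?thesis by auto
qed

lemma R_total: "\<exists>i\<le>d. (x, y) \<in> R i"
proof -
  have "(\<Union>i\<le>d. R i) = UNIV"
    using scheme unfolding association_scheme_def by (elim conjE)
  then have "(x, y) \<in> (\<Union>i\<le>d. R i)" by (simp only: UNIV_I)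
  then show ?thesis by blast
qed

lemma R_unique: "\<lbrakk>(x, y) \<in> R i; (x, y) \<in> R j; i \<le> d; j \<le> d\<rbrakk> \<Longrightarrow> i = j"
proof (rule ccontr)
  assume a: "(x, y) \<in> R i" "(x, y) \<in> R j" "i \<le> d" "j \<le> d" "i \<noteq> j"
  have "disjoint_family_on R {..d}" using scheme by (simp add: association_scheme_def)
  then have "R i \<inter> R j = {}" using a by (simp add: disjoint_family_on_def)
  then show False using a by blast
qed

lemma tr_props: assumes "i \<le> d" shows "tr i \<le> d \<and> (R i)\<inverse> = R (tr i)"
proof -
  have "\<forall>i\<le>d. \<exists>j\<le>d. (R i)\<inverse> = R j"
    using scheme unfolding association_scheme_def by (elim conjE)
  then obtain j where j: "j \<le> d" "(R i)\<inverse> = R j" using assms by blast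
  have "j' = j" if "j' \<le> d \<and> (R i)\<inverse> = R j'" for j'
    using that j R_nonempty[of j] R_unique by metis
  then show ?thesis unfolding transp_idx_def using j
    by (intro theI[of "\<lambda>j. j \<le> d \<and> (R i)\<inverse> = R j" j]) auto
qed

lemma tr_le [simp]: "i \<le> d \<Longrightarrow> tr i \<le> d"
  using tr_props by blast

lemma tr_iff: "i \<le> d \<Longrightarrow> (x, y) \<in> R (tr i) \<longleftrightarrow> (y, x) \<in> R i"
  using tr_props by blast

lemma tr_tr [simp]: "i \<le> d \<Longrightarrow> tr (tr i) = i"
  using R_nonempty[of i] R_unique[of _ _ "tr (tr i)" i] tr_iff tr_le by metis

lemma tr_inj: "\<lbrakk>i \<le> d; j \<le> d\<rbrakk> \<Longrightarrow> tr i = tr j \<longleftrightarrow> i = j"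
  by (metis tr_tr)

lemma tr_0 [simp]: "tr 0 = 0"
  using R_unique[of _ _ "tr 0" 0] tr_iff[of 0] R_0 by auto

lemma p_eq_card:
  assumes "i \<le> d" "j \<le> d" "l \<le> d" "(x, y) \<in> R l"
  shows "p i j l = card {z. (x, z) \<in> R i \<and> (z, y) \<in> R j}"
proof -
  have "\<forall>i\<le>d. \<forall>j\<le>d. \<forall>l\<le>d. \<exists>n. \<forall>(x, y)\<in>R l. int_count d R i j x y = n"
    using scheme unfolding association_scheme_def by (elim conjE)
  then obtain n where n: "\<forall>(x, y)\<in>R l. int_count d R i j x y = n"
    using assms by blast
  have "p i j l = n" unfolding int_num_def
    using n assms(4) by (intro the_equality) auto
  moreover have "R i `` {x} \<inter> R (tr j) `` {y} = {z. (x, z) \<in> R i \<and> (z, y) \<in> R j}"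
    using tr_iff[OF assms(2)] by auto
  ultimately show ?thesis using n assms(4) by (auto simp: int_count_def)
qed

lemma p_neq_0I:
  assumes "(x, z) \<in> R i" "(z, y) \<in> R j" "(x, y) \<in> R l" "i \<le> d" "j \<le> d" "l \<le> d"
  shows "p i j l \<noteq> 0"
proof -
  have "z \<in> {z. (x, z) \<in> R i \<and> (z, y) \<in> R j}" using assms by simp
  then show ?thesis unfolding p_eq_card[OF assms(4-6,3)] by (metis card_0_eq empty_iff finite)
qed

lemma p_neq_0E:
  assumes "p i j l \<noteq> 0" "(x, y) \<in> R l" "i \<le> d" "j \<le> d" "l \<le> d"
  obtains z where "(x, z) \<in> R i" "(z, y) \<in> R j"
proof -
  have "{z. (x, z) \<in> R i \<and> (z, y) \<in> R j} \<noteq> {}"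
    using assms(1) unfolding p_eq_card[OF assms(3-5,2)] by (metis card.empty)
  then show ?thesis using that by blast
qed

lemma p_eq_1_unique:
  assumes "p i j l = 1" "(x, y) \<in> R l" "i \<le> d" "j \<le> d" "l \<le> d"
    "(x, z) \<in> R i" "(z, y) \<in> R j" "(x, z') \<in> R i" "(z', y) \<in> R j"
  shows "z = z'"
proof -
  have "card {z. (x, z) \<in> R i \<and> (z, y) \<in> R j} = 1"
    using assms(1) unfolding p_eq_card[OF assms(3-5,2)] .
  then obtain t where "{z. (x, z) \<in> R i \<and> (z, y) \<in> R j} = {t}"
    by (rule card_1_singletonE)
  moreover have "{z, z'} \<subseteq> {z. (x, z) \<in> R i \<and> (z, y) \<in> R j}" using assms(6-9) by simp
  ultimately show ?thesis by auto
qed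

lemma p_commute: "\<lbrakk>i \<le> d; j \<le> d; l \<le> d\<rbrakk> \<Longrightarrow> p i j l = p j i l"
  using commutative_scheme by (simp add: commutative_scheme_def)

lemma valency_eq_card: "i \<le> d \<Longrightarrow> k i = card {z. (x, z) \<in> R i}"
  unfolding valency_def using p_eq_card[of i "tr i" 0 x x] by (simp add: R_0 tr_iff)

lemma valency_tr [simp]: "i \<le> d \<Longrightarrow> k (tr i) = k i"
  unfolding valency_def by (simp add: p_commute)

lemma valency_pos: "i \<le> d \<Longrightarrow> k i > 0"
proof -
  assume "i \<le> d"
  moreover obtain x y where "(x, y) \<in> R i" using R_nonempty[OF \<open>i \<le> d\<close>] by blast
  ultimately show ?thesis by (auto simp: valency_eq_card[of i x] card_gt_0_iff)
qed

lemma valency_0 [simp]: "k 0 = 1"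
  using valency_eq_card[of 0 undefined] by (simp add: R_0)

lemma p_0_right: "\<lbrakk>i \<le> d; l \<le> d\<rbrakk> \<Longrightarrow> p i 0 l = (if l = i then 1 else 0)"
proof -
  assume a: "i \<le> d" "l \<le> d"
  obtain x y where xy: "(x, y) \<in> R l" using R_nonempty a by blast
  have "{z. (x, z) \<in> R i \<and> (z, y) \<in> R 0} = (if l = i then {y} else {})"
    using xy a R_unique by (auto simp: R_0)
  then show ?thesis using p_eq_card[OF a(1) _ a(2) xy] by simp
qed

lemma p_0_upper: "\<lbrakk>i \<le> d; j \<le> d\<rbrakk> \<Longrightarrow> p i j 0 = (if j = tr i then k i else 0)"
proof -
  assume a: "i \<le> d" "j \<le> d"
  have "p i j 0 = card {z. (undefined, z) \<in> R i \<and> (z, undefined) \<in> R j}"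
    using p_eq_card[of i j 0] a by (simp add: R_0)
  moreover have "{z. (undefined, z) \<in> R i \<and> (z, undefined) \<in> R j} = {}" if "j \<noteq> tr i"
    using that a R_unique[of _ _ j "tr i"] by (auto simp: tr_iff)
  ultimately show ?thesis by (auto simp: valency_def)
qed

lemma p_tr: "\<lbrakk>i \<le> d; j \<le> d; l \<le> d\<rbrakk> \<Longrightarrow> p (tr i) (tr j) (tr l) = p i j l"
proof -
  assume a: "i \<le> d" "j \<le> d" "l \<le> d"
  obtain x y where xy: "(x, y) \<in> R l" using R_nonempty a by blast
  have "p (tr i) (tr j) (tr l) = card {z. (y, z) \<in> R (tr i) \<and> (z, x) \<in> R (tr j)}"
    using a xy by (intro p_eq_card) (auto simp: tr_iff)
  also have "\<dots> = p j i l" using a p_eq_card[of j i l x y] xy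
    by (simp add: tr_iff conj_commute)
  finally show ?thesis using a p_commute by simp
qed

text \<open>Double count of the pairs (z, w) on walks from x to y with steps x to z in
  \<open>R i\<close>, z to w in \<open>R j\<close>, w to y in \<open>R l\<close>: the left side
  sorts them by the class of (x, w), the right side by that of (z, y).\<close>

lemma p_assoc:
  assumes "i \<le> d" "j \<le> d" "l \<le> d" "m \<le> d"
  shows "(\<Sum>e\<le>d. p i j e * p e l m) = (\<Sum>e\<le>d. p j l e * p i e m)"
proof -
  obtain x y where xy: "(x, y) \<in> R m" using R_nonempty assms by blast
  let ?P = "{(z, w). (x, z) \<in> R i \<and> (z, w) \<in> R j \<and> (w, y) \<in> R l}"
  have "?P = (\<Union>e\<le>d. (\<lambda>(w, z). (z, w)) ` (SIGMA w:{w. (x, w) \<in> R e \<and> (w, y) \<in> R l}. {z. (x, z) \<in> R i \<and> (z, w) \<in> R j}))"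
    (is "_ = ?Q")
  proof (rule set_eqI)
    fix zw show "zw \<in> ?P \<longleftrightarrow> zw \<in> ?Q"
      using R_total[of x "snd zw"] by (cases zw) (auto simp: image_iff)
  qed
  also have "card \<dots> = (\<Sum>e\<le>d. card (SIGMA w:{w. (x, w) \<in> R e \<and> (w, y) \<in> R l}. {z. (x, z) \<in> R i \<and> (z, w) \<in> R j}))"
    by (subst card_UN_disjoint)
      (auto simp: card_image inj_on_def simp del: card_SigmaI dest: R_unique)
  also have "\<dots> = (\<Sum>e\<le>d. \<Sum>w | (x, w) \<in> R e \<and> (w, y) \<in> R l. p i j e)"
    using assms by (intro sum.cong refl) (auto intro!: sum.cong simp: card_SigmaI p_eq_card[symmetric])
  also have "\<dots> = (\<Sum>e\<le>d. p i j e * p e l m)"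
    using assms xy by (intro sum.cong refl) (simp add: p_eq_card[of _ l m x y])
  finally have 1: "card ?P = (\<Sum>e\<le>d. p i j e * p e l m)" .
  have "?P = (\<Union>e\<le>d. (SIGMA z:{z. (x, z) \<in> R i \<and> (z, y) \<in> R e}. {w. (z, w) \<in> R j \<and> (w, y) \<in> R l}))"
    (is "_ = ?Q")
  proof (rule set_eqI)
    fix zw show "zw \<in> ?P \<longleftrightarrow> zw \<in> ?Q"
      using R_total[of "fst zw" y] by (cases zw) auto
  qed
  also have "card \<dots> = (\<Sum>e\<le>d. card (SIGMA z:{z. (x, z) \<in> R i \<and> (z, y) \<in> R e}. {w. (z, w) \<in> R j \<and> (w, y) \<in> R l}))"
    by (subst card_UN_disjoint) (auto simp del: card_SigmaI dest: R_unique)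
  also have "\<dots> = (\<Sum>e\<le>d. \<Sum>z | (x, z) \<in> R i \<and> (z, y) \<in> R e. p j l e)"
    using assms by (intro sum.cong refl) (auto intro!: sum.cong simp: card_SigmaI p_eq_card[symmetric])
  also have "\<dots> = (\<Sum>e\<le>d. p j l e * p i e m)"
    using assms xy by (intro sum.cong refl) (simp add: p_eq_card[of i _ m x y])
  finally show ?thesis using 1 by simp
qed

text \<open>Up to the factor \<open>CARD('a)\<close> both sides count closed oriented triangles with
  sides in the classes \<open>i\<close>, \<open>j\<close>, \<open>l\<close>, seen from different
  sides. Formally this is associativity at the upper index 0.\<close>

lemma p_cyclic:
  assumes "i \<le> d" "j \<le> d" "l \<le> d"
  shows "k l * p i j (tr l) = k i * p j l (tr i)"
proof -
  have "(\<Sum>e\<le>d. p i j e * p e l 0) = (\<Sum>e\<le>d. if e = tr l then p i j e * k l else 0)"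
    using assms by (intro sum.cong) (auto simp: p_0_upper tr_inj)
  moreover have "(\<Sum>e\<le>d. p j l e * p i e 0) = (\<Sum>e\<le>d. if e = tr i then p j l e * k i else 0)"
    using assms by (intro sum.cong) (auto simp: p_0_upper)
  ultimately show ?thesis using p_assoc[OF assms, of 0] assms by (simp add: mult.commute)
qed

lemma p_upper_exchange:
  assumes "i \<le> d" "j \<le> d" "l \<le> d"
  shows "k l * p i j l = k i * p l (tr j) i"
  using p_cyclic[of i j "tr l"] p_tr[of j "tr l" "tr i"] assms p_commute[of "tr j" l i]
  by simp

lemma p_row_sum:
  assumes "i \<le> d" "j \<le> d"
  shows "(\<Sum>l\<le>d. k l * p i j l) = k i * k j"
proof -
  have "(\<Sum>l\<le>d. k l * p i j l) = k i * (\<Sum>l\<le>d. p l (tr j) i)"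
    unfolding sum_distrib_left using assms by (intro sum.cong refl p_upper_exchange) auto
  moreover have "(\<Sum>l\<le>d. p l (tr j) i) = k j"
  proof -
    obtain x y where xy: "(x, y) \<in> R i" using R_nonempty assms by blast
    have "(\<Sum>l\<le>d. p l (tr j) i) = (\<Sum>l\<le>d. card {z. (x, z) \<in> R l \<and> (z, y) \<in> R (tr j)})"
      using assms xy by (intro sum.cong refl p_eq_card) auto
    also have "\<dots> = card (\<Union>l\<le>d. {z. (x, z) \<in> R l \<and> (z, y) \<in> R (tr j)})"
      by (subst card_UN_disjoint) (auto dest: R_unique)
    also have "(\<Union>l\<le>d. {z. (x, z) \<in> R l \<and> (z, y) \<in> R (tr j)}) = {z. (y, z) \<in> R j}"
      (is "?P = ?Q")
    proof (rule set_eqI)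
      fix z show "z \<in> ?P \<longleftrightarrow> z \<in> ?Q"
        using R_total[of x z] assms by (auto simp: tr_iff)
    qed
    finally show ?thesis using assms by (simp add: valency_eq_card[of j y])
  qed
  ultimately show ?thesis by simp
qed

lemma card_points: "CARD('a) = (\<Sum>l\<le>d. k l)"
proof -
  have "z \<in> (\<Union>l\<le>d. {z. (undefined, z) \<in> R l})" for z
    using R_total[of undefined z] by auto
  then have "(UNIV :: 'a set) = (\<Union>l\<le>d. {z. (undefined, z) \<in> R l})" by blast
  then have "CARD('a) = card (\<Union>l\<le>d. {z. (undefined :: 'a, z) \<in> R l})" by (rule arg_cong)
  also have "\<dots> = (\<Sum>l\<le>d. card {z. (undefined :: 'a, z) \<in> R l})"
    by (subst card_UN_disjoint) (auto dest: R_unique)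
  finally show ?thesis by (simp add: valency_eq_card[of _ undefined])
qed

text \<open>Stability under the generator alone suffices. The stabilizer \<open>H\<close> of
  \<open>F\<close> is closed under products by associativity and under transposition because
  \<open>F\<close> is, so it is a closed subset containing \<open>q\<close>, hence everything. Since
  0 lies in \<open>F\<close>, every element of \<open>H\<close> lies in \<open>F\<close>.\<close>

lemma generates_imp_eq_all:
  assumes gen: "generates d R q" and q: "q \<le> d" and F: "F \<subseteq> {..d}" "0 \<in> F"
    and tr: "\<And>i. i \<in> F \<Longrightarrow> tr i \<in> F"
    and prod: "\<And>j m. \<lbrakk>j \<in> F; m \<le> d; p q j m \<noteq> 0\<rbrakk> \<Longrightarrow> m \<in> F"
  shows "F = {..d}"
proof -
  define H where "H = {i. i \<le> d \<and> (\<forall>j\<in>F. \<forall>m\<le>d. p i j m \<noteq> 0 \<longrightarrow> m \<in> F)}"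
  have HI: "i \<in> H" if "i \<le> d" "\<And>j m. \<lbrakk>j \<in> F; m \<le> d; p i j m \<noteq> 0\<rbrakk> \<Longrightarrow> m \<in> F" for i
    unfolding H_def using that by blast
  have Hle: "i \<le> d" if "i \<in> H" for i
    using that by (simp add: H_def)
  have HD: "m \<in> F" if "i \<in> H" "j \<in> F" "m \<le> d" "p i j m \<noteq> 0" for i j m
    using that unfolding H_def by blast
  have Fle: "j \<le> d" if "j \<in> F" for j
    using that F(1) by auto
  have Htr: "tr i \<in> H" if i: "i \<in> H" for i
  proof (rule HI)
    show "tr i \<le> d" using i Hle by simp
    fix j m assume jm: "j \<in> F" "m \<le> d" "p (tr i) j m \<noteq> 0"
    have "p i (tr j) (tr m) \<noteq> 0"
      using p_tr[of "tr i" j m] Hle[OF i] Fle[OF jm(1)] jm(2,3) by simp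
    then have "tr m \<in> F" using HD[OF i tr[OF jm(1)]] jm(2) by simp
    then show "m \<in> F" using tr[of "tr m"] jm(2) by simp
  qed
  have Hmul: "e \<in> H" if i: "i \<in> H" "j \<in> H" and e: "e \<le> d" "p i j e \<noteq> 0" for i j e
  proof (rule HI)
    show "e \<le> d" by fact
    fix l m assume lm: "l \<in> F" "m \<le> d" "p e l m \<noteq> 0"
    have "(\<Sum>e\<le>d. p i j e * p e l m) \<noteq> 0"
    proof
      assume "(\<Sum>e\<le>d. p i j e * p e l m) = 0"
      then have "\<forall>e\<in>{..d}. p i j e * p e l m = 0" by (subst (asm) sum_eq_0_iff) auto
      then have "p i j e * p e l m = 0" using e(1) by blast
      then show False using e(2) lm(3) by simp
    qed
    then have "(\<Sum>e\<le>d. p j l e * p i e m) \<noteq> 0"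
      using p_assoc[OF Hle[OF i(1)] Hle[OF i(2)] Fle[OF lm(1)] lm(2)] by (simp only: not_False_eq_True)
    then obtain e' where e': "e' \<le> d" "p j l e' * p i e' m \<noteq> 0"
      by (meson sum.neutral atMost_iff)
    then have "e' \<in> F" using HD[OF i(2) lm(1)] by simp
    then show "m \<in> F" using HD[OF i(1)] lm(2) e'(2) by simp
  qed
  have qH: "q \<in> H" by (rule HI[OF q prod])
  have "closed_subset d R H"
    unfolding closed_subset_def
  proof (intro conjI ballI subsetI)
    show "H \<noteq> {}" using qH by blast
    show "x \<in> {..d}" if "x \<in> H" for x using that Hle by simp
    show "e \<in> H" if "i \<in> H" "j \<in> H" "e \<in> complex_prod d R {tr i} {j}" for i j e
      using that Hmul[OF Htr, of i j e] by (simp add: complex_prod_def)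
  qed
  with qH have "{..d} \<subseteq> H" using gen unfolding generates_def by blast
  then have "i \<in> F" if "i \<le> d" for i
  proof -
    have "i \<in> H" using that \<open>{..d} \<subseteq> H\<close> by auto
    then show ?thesis using that HD[of i 0 i] F(2) p_0_right[of i i] by simp
  qed
  then show ?thesis using F by auto
qed

subsection \<open>The Bose-Mesner algebra\<close>

abbreviation A :: "nat \<Rightarrow> complex^'a^'a" where "A i \<equiv> adj_matrix (R i)"

lemma A_nth: "\<lbrakk>(x, y) \<in> R l; l \<le> d; i \<le> d\<rbrakk> \<Longrightarrow> A i $ x $ y = (if l = i then 1 else 0)"
  by (auto simp: adj_matrix_def dest: R_unique)

lemma A_0: "A 0 = mat 1"
  by (simp add: adj_matrix_def mat_def R_0 vec_eq_iff)

lemma A_mult_nth: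
  assumes "(x, y) \<in> R l" "i \<le> d" "j \<le> d" "l \<le> d"
  shows "(A i ** A j) $ x $ y = of_nat (p i j l)"
proof -
  have "(A i ** A j) $ x $ y = (\<Sum>z\<in>UNIV. if (x, z) \<in> R i \<and> (z, y) \<in> R j then 1 else 0)"
    unfolding matrix_matrix_mult_def adj_matrix_def by (auto intro!: sum.cong)
  also have "\<dots> = of_nat (card {z. (x, z) \<in> R i \<and> (z, y) \<in> R j})"
    by (subst sum.If_cases) auto
  finally show ?thesis using p_eq_card[OF assms(2,3,4,1)] by simp
qed

lemma scheme_matrix_eqI:
  assumes "\<And>x y l. \<lbrakk>l \<le> d; (x, y) \<in> R l\<rbrakk> \<Longrightarrow> M $ x $ y = N $ x $ y"
  shows "M = N"
  using assms R_total by (metis matrix_eqI)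

lemma trace_A: "i \<le> d \<Longrightarrow> i \<noteq> 0 \<Longrightarrow> trace (A i) = 0"
proof -
  assume "i \<le> d" "i \<noteq> 0"
  then have "(x, x) \<notin> R i" for x using R_unique[of x x i 0] R_0 by auto
  then show ?thesis by (simp add: trace_def adj_matrix_def)
qed

lemma A_row: "i \<le> d \<Longrightarrow> A i ** all_ones = of_nat (k i) *\<^sub>m all_ones"
proof (rule matrix_eqI)
  fix x y assume i: "i \<le> d"
  have "(A i ** all_ones) $ x $ y = (\<Sum>z\<in>UNIV. if (x, z) \<in> R i then 1 else 0)"
    by (simp add: matrix_matrix_mult_def adj_matrix_def all_ones_def)
  also have "\<dots> = of_nat (card {z. (x, z) \<in> R i})" by (subst sum.If_cases) auto
  finally show "(A i ** all_ones) $ x $ y = (of_nat (k i) *\<^sub>m all_ones) $ x $ y"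
    using i by (simp add: valency_eq_card[of i x] all_ones_def)
qed

lemma A_col: "i \<le> d \<Longrightarrow> all_ones ** A i = of_nat (k i) *\<^sub>m all_ones"
proof (rule matrix_eqI)
  fix x y assume i: "i \<le> d"
  have "(all_ones ** A i) $ x $ y = (\<Sum>z\<in>UNIV. if (y, z) \<in> R (tr i) then 1 else 0)"
    using i by (simp add: matrix_matrix_mult_def adj_matrix_def all_ones_def tr_iff)
  also have "\<dots> = of_nat (card {z. (y, z) \<in> R (tr i)})" by (subst sum.If_cases) auto
  finally show "(all_ones ** A i) $ x $ y = (of_nat (k i) *\<^sub>m all_ones) $ x $ y"
    using i valency_eq_card[of "tr i" y] by (simp add: all_ones_def)
qed

abbreviation BM where "BM \<equiv> bose_mesner d R"

lemma BM_I: "(\<And>x y. M $ x $ y = (\<Sum>i\<le>d. e i * A i $ x $ y)) \<Longrightarrow> M \<in> BM"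
  unfolding bose_mesner_def by (rule image_eqI[where x = e]) (simp_all add: vec_eq_iff)

lemma BM_E:
  assumes "M \<in> BM"
  obtains e where "\<And>x y. M $ x $ y = (\<Sum>i\<le>d. e i * A i $ x $ y)"
proof -
  obtain e where "M = (\<chi> x y. \<Sum>i\<le>d. e i * A i $ x $ y)"
    using assms unfolding bose_mesner_def by blast
  then show thesis by (intro that[of e]) simp
qed

lemma BM_add: "M \<in> BM \<Longrightarrow> N \<in> BM \<Longrightarrow> M + N \<in> BM"
proof -
  assume M: "M \<in> BM" and N: "N \<in> BM"
  obtain e where e: "\<And>x y. M $ x $ y = (\<Sum>i\<le>d. e i * A i $ x $ y)" using BM_E[OF M] by blast
  obtain e' where e': "\<And>x y. N $ x $ y = (\<Sum>i\<le>d. e' i * A i $ x $ y)" using BM_E[OF N] by blast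
  show ?thesis
    by (rule BM_I[where e = "\<lambda>i. e i + e' i"]) (simp add: e e' distrib_right sum.distrib)
qed

lemma BM_cscale: "M \<in> BM \<Longrightarrow> c *\<^sub>m M \<in> BM"
proof -
  assume M: "M \<in> BM"
  obtain e where e: "\<And>x y. M $ x $ y = (\<Sum>i\<le>d. e i * A i $ x $ y)" using BM_E[OF M] by blast
  show ?thesis
    by (rule BM_I[where e = "\<lambda>i. c * e i"]) (simp add: e sum_distrib_left mult.assoc)
qed

lemma BM_diff: "M \<in> BM \<Longrightarrow> N \<in> BM \<Longrightarrow> M - N \<in> BM"
proof -
  assume "M \<in> BM" "N \<in> BM"
  moreover have "M - N = M + (- 1) *\<^sub>m N" by (simp add: vec_eq_iff)
  ultimately show ?thesis using BM_add BM_cscale by metis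
qed

lemma BM_A: "i \<le> d \<Longrightarrow> A i \<in> BM"
proof -
  assume i: "i \<le> d"
  have "(\<Sum>j\<le>d. (if j = i then 1 else 0) * A j $ x $ y) = (\<Sum>j\<le>d. if j = i then A i $ x $ y else 0)" for x y
    by (intro sum.cong) auto
  then show ?thesis using i by (intro BM_I[where e = "\<lambda>j. if j = i then 1 else 0"]) simp
qed

text \<open>If the whole algebra acts on \<open>E\<close> by scalars, an idempotent below
  \<open>E\<close> is t E with t^2 = t.\<close>

lemma eigen_imp_primitive_idempotent:
  assumes E: "E \<in> BM" "E \<noteq> 0" "E ** E = E"
    and eig: "\<And>i. i \<le> d \<Longrightarrow> \<exists>l. E ** A i = l *\<^sub>m E"
  shows "primitive_idempotent BM E"
  unfolding primitive_idempotent_def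
proof (intro conjI ballI impI E)
  fix F assume F: "F \<in> BM" "F ** F = F \<and> E ** F = F \<and> F ** E = F"
  obtain l where l: "\<And>i. i \<le> d \<Longrightarrow> E ** A i = l i *\<^sub>m E" using eig by metis
  obtain e where e: "\<And>x y. F $ x $ y = (\<Sum>i\<le>d. e i * A i $ x $ y)"
    using BM_E[OF F(1)] by blast
  have "E ** F = (\<Sum>i\<le>d. e i * l i) *\<^sub>m E"
  proof (rule matrix_eqI)
    fix x y
    have "(E ** F) $ x $ y = (\<Sum>i\<le>d. e i * (E ** A i) $ x $ y)"
      unfolding matrix_matrix_mult_def
      by (simp add: e sum_distrib_left) (subst sum.swap, simp add: mult_ac)
    also have "\<dots> = (\<Sum>i\<le>d. e i * (l i * E $ x $ y))"
      by (intro sum.cong refl) (simp add: l)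
    finally show "(E ** F) $ x $ y = ((\<Sum>i\<le>d. e i * l i) *\<^sub>m E) $ x $ y"
      by (simp add: sum_distrib_right mult.assoc)
  qed
  then obtain t where t: "F = t *\<^sub>m E" using F(2) by metis
  have "(t * t) *\<^sub>m E = t *\<^sub>m E" using F(2) unfolding t by (simp add: cscale_simps E(3))
  moreover obtain x y where "E $ x $ y \<noteq> 0" using E(2) by (metis matrix_eqI zero_index)
  ultimately have "t * t = t" by (metis cscale_nth mult_right_cancel)
  then have "t = 0 \<or> t = 1" by simp
  then show "F = 0 \<or> F = E" using t by (auto simp: vec_eq_iff)
qed

end

subsection \<open>The parameters of the scheme\<close>

text \<open>\<open>u\<close> and \<open>w\<close> stand for the indices 1 and 2; the inclusions for
  products of relations become support conditions on intersection numbers.\<close>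

locale narrow_scheme = commutative_association_scheme d R
  for d :: nat and R :: "nat \<Rightarrow> 'a::finite rel" +
  fixes u w :: nat
  assumes u_le [simp]: "u \<le> d" and w_le [simp]: "w \<le> d"
    and u_nonsym: "tr u \<noteq> u" and w_nonsym: "tr w \<noteq> w"
    and w_neq_u: "w \<noteq> u" and w_neq_tr_u: "w \<noteq> tr u"
    and gen: "generates d R u"
    and p_uu_imp: "\<And>m. \<lbrakk>m \<le> d; p u u m \<noteq> 0\<rbrakk> \<Longrightarrow> m \<in> {u, tr u, w}"
    and p_uu'_imp: "\<And>m. \<lbrakk>m \<le> d; p u (tr u) m \<noteq> 0\<rbrakk> \<Longrightarrow> m \<in> {0, u, tr u, w, tr w}"
    and val_w [simp]: "k w = k u" and val_gt_1: "k u > 1"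
begin

abbreviation u' where "u' \<equiv> tr u"
abbreviation w' where "w' \<equiv> tr w"
abbreviation K where "K \<equiv> k u"
text \<open>\<open>g\<close> and \<open>h\<close> are the coefficients of B and B^T in B A^T, and
  \<open>v\<close> is that of B^T in A B. Together with \<open>K\<close>, \<open>a\<close>,
  \<open>b\<close>, \<open>c\<close>, \<open>f\<close> they determine, by exchange and
  transposition, all products of \<open>u\<close> with the named classes up to their components in
  \<open>L\<close>.\<close>

abbreviation a where "a \<equiv> p u u u"
abbreviation b where "b \<equiv> p u u u'"
abbreviation c where "c \<equiv> p u u w"
abbreviation f where "f \<equiv> p u u' w"
abbreviation g where "g \<equiv> p w u' w"
abbreviation h where "h \<equiv> p w u' w'"
abbreviation v where "v \<equiv> p u w w'"
text \<open>The surplus classes: \<open>d = 4\<close> amounts to this set being empty.\<close>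

abbreviation L where "L \<equiv> {..d} - {0, u, u', w, w'}"

lemma distinct_idx [simp]:
  "u \<noteq> 0" "u' \<noteq> 0" "w \<noteq> 0" "w' \<noteq> 0" "u \<noteq> u'" "u' \<noteq> u" "w \<noteq> w'" "w' \<noteq> w"
  "u \<noteq> w" "w \<noteq> u" "u \<noteq> w'" "w' \<noteq> u" "u' \<noteq> w" "w \<noteq> u'" "u' \<noteq> w'" "w' \<noteq> u'"
  "0 \<noteq> u" "0 \<noteq> u'" "0 \<noteq> w" "0 \<noteq> w'"
  using u_nonsym w_nonsym w_neq_u w_neq_tr_u tr_0 tr_inj[of w u] tr_inj[of w "tr u"]
    tr_inj[of u 0] tr_inj[of w 0]
  by auto

lemma sum_idx_split:
  fixes F :: "nat \<Rightarrow> nat"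
  shows "(\<Sum>e\<le>d. F e) = F 0 + F u + F u' + F w + F w' + (\<Sum>e\<in>L. F e)"
proof -
  have "(\<Sum>e\<le>d. F e) = (\<Sum>e\<in>L. F e) + (\<Sum>e\<in>{0, u, u', w, w'}. F e)"
    by (intro sum.subset_diff) auto
  then show ?thesis by simp
qed

lemma p_values [simp]:
  "p u u 0 = 0" "p u u w' = 0"
  "p u u' 0 = K" "p u u' u = a" "p u u' u' = a" "p u u' w' = f"
  "p u' u' 0 = 0" "p u' u' u = b" "p u' u' u' = a" "p u' u' w = 0" "p u' u' w' = c"
  "p w u' 0 = 0" "p w u' u = c" "p w u' u' = f"
  "p u w 0 = 0" "p u w u = f" "p u w u' = 0" "p u w w = g"
  "p u w' 0 = 0" "p u w' u = f" "p u w' u' = c" "p u w' w = h" "p u w' w' = g"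
proof -
  have K: "K > 0" using val_gt_1 by simp
  show 1: "p u u 0 = 0" "p u u' 0 = K" "p w u' 0 = 0" "p u w 0 = 0" "p u w' 0 = 0" "p u' u' 0 = 0"
    by (simp_all add: p_0_upper tr_inj)
  show 2: "p u u w' = 0" using p_uu_imp[of w'] by auto
  show 3: "p u u' u = a" using p_upper_exchange[of u u' u] K by simp
  show 4: "p u u' u' = a" using p_tr[of u u' u'] p_commute[of u' u u] 3 by simp
  show 5: "p u u' w' = f" using p_tr[of u u' w'] p_commute[of u' u w] by simp
  show 6: "p u' u' u = b" "p u' u' u' = a" "p u' u' w = 0" "p u' u' w' = c"
    using p_tr[of u u u'] p_tr[of u u u] p_tr[of u u w'] p_tr[of u u w] 2 by simp_all
  show 7: "p w u' u = c" using p_upper_exchange[of u u w] K by simp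
  have "p w' u u = f" using p_upper_exchange[of u u' w'] K 5 by simp
  then show 8: "p w u' u' = f" using p_tr[of w u' u'] by simp
  show 9: "p u w u = f" using p_upper_exchange[of u u' w] K p_commute[of u w u] by simp
  show 10: "p u w u' = 0" using p_upper_exchange[of u' u' w] K p_commute[of u w u'] 6 by simp
  show 11: "p u w w = g" using p_upper_exchange[of w u w] K p_commute[of u w w] by simp
  show "p u w' u = f" "p u w' u' = c" "p u w' w = h" "p u w' w' = g"
    using p_tr[of u w' u] p_tr[of u w' u'] p_tr[of u w' w] p_tr[of u w' w'] 7 8
      p_commute[of u' w u'] p_commute[of u' w u] p_commute[of u' w w] p_commute[of u' w w'] by simp_all
qed

lemma p_L [simp]:
  assumes "m \<in> L"
  shows "p u u m = 0" "p u u' m = 0" "p u' u' m = 0"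
proof -
  show "p u u m = 0" "p u u' m = 0" using assms p_uu_imp[of m] p_uu'_imp[of m] by auto
  have "tr m \<notin> {u, u', w}" "tr m \<le> d"
    using assms tr_inj[of m u] tr_inj[of m u'] tr_inj[of m w'] by auto
  then show "p u' u' m = 0" using p_tr[of u u "tr m"] p_uu_imp[of "tr m"] assms by auto
qed

lemma p_uw'_eq: "m \<le> d \<Longrightarrow> p u w' m = p w u' (tr m)"
  using p_tr[of u w' m] p_commute[of u' w "tr m"] by simp

lemma K_pos: "K > 0"
  using val_gt_1 by simp

text \<open>
  With \<open>A\<close>, \<open>B\<close> the adjacency matrices of \<open>u\<close>, \<open>w\<close>: \<open>A\<^sup>2 = aA + bA\<^sup>T + cB\<close> and
  \<open>AA\<^sup>T = K I + a(A + A\<^sup>T) + f(B + B\<^sup>T)\<close>. Comparing coefficients in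
  \<open>(AA)A\<^sup>T = A(AA\<^sup>T)\<close> gives the equations of \<open>master\<close>.
\<close>

lemma val_eq_1: "K = a + b + c"
proof -
  have "K * K = K * (a + b + c)"
    using p_row_sum[of u u] unfolding sum_idx_split by (simp add: algebra_simps)
  then show ?thesis using K_pos by (metis mult_left_cancel less_numeral_extra(3))
qed

lemma val_eq_2: "K = 1 + 2 * a + 2 * f"
proof -
  have "K * K = K * (1 + 2 * a + 2 * f)"
    using p_row_sum[of u u'] unfolding sum_idx_split by (simp add: algebra_simps)
  then show ?thesis using K_pos by (metis mult_left_cancel less_numeral_extra(3))
qed

lemma master:
  assumes "m \<le> d"
  shows "a * p u u' m + b * p u' u' m + c * p w u' m =
    K * p u 0 m + a * p u u m + a * p u u' m + f * p u w m + f * p u w' m"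
  using p_assoc[of u u u' m] assms unfolding sum_idx_split by simp

lemma master_u: "b * b + c * c = K + a * a + 2 * f * f"
  using master[of u] by (simp add: p_0_right)

lemma master_w: "c * g = a * c + f * g + f * h"
  using master[of w] by (simp add: p_0_right)

lemma master_w': "b * c + c * h = f * v + f * g"
  using master[of w'] by (simp add: p_0_right)

lemma master_L: "m \<in> L \<Longrightarrow> c * p w u' m = f * p u w m + f * p w u' (tr m)"
  using master[of m] by (simp add: p_0_right p_uw'_eq)

lemma row_wu': "K * K = K * (c + f + g + h) + (\<Sum>m\<in>L. k m * p w u' m)"
  using p_row_sum[of w u'] unfolding sum_idx_split by (simp add: algebra_simps)

lemma row_uw: "K * K = K * (f + g + v) + (\<Sum>m\<in>L. k m * p u w m)"
  using p_row_sum[of u w] unfolding sum_idx_split by (simp add: algebra_simps)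

lemma tr_L: "m \<in> L \<Longrightarrow> tr m \<in> L"
  using tr_inj[of m 0] tr_inj[of m u] tr_inj[of m u'] tr_inj[of m w] tr_inj[of m w'] by auto

text \<open>For f = 0 the out-neighbours of a point form a tournament, each with out-degree
  \<open>a\<close> inside it. For b = 0 there are no cyclic triangles, so the tournament is
  transitive, and an arc from y to z makes the out-degree of y exceed that of z.\<close>

lemma not_f_b_zero:
  assumes f0: "f = 0" and b0: "b = 0"
  shows False
proof -
  have a: "a \<noteq> 0" using val_eq_2 f0 val_gt_1 by auto
  obtain x z where xz: "(x, z) \<in> R u" using R_nonempty[OF u_le] by blast
  obtain y where y: "(x, y) \<in> R u" "(y, z) \<in> R u" using p_neq_0E[OF a xz] by auto
  let ?C = "\<lambda>s. {t. (x, t) \<in> R u \<and> (s, t) \<in> R u}"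
  have common: "card (?C s) = a" if "(x, s) \<in> R u" for s
    using p_eq_card[of u u' u x s] that by (simp add: tr_iff)
  have "(y, t) \<in> R u" if t: "(x, t) \<in> R u" "(z, t) \<in> R u" for t
  proof -
    obtain i where i: "i \<le> d" "(y, t) \<in> R i" using R_total by blast
    have "p u' u i \<noteq> 0" using p_neq_0I[of y x u' t u i] y t i by (simp add: tr_iff)
    then have "i \<in> {0, u, u', w, w'}" using p_uu'_imp[OF i(1)] p_commute[of u u' i] i by simp
    moreover have "i \<noteq> w" "i \<noteq> w'" using \<open>p u' u i \<noteq> 0\<close> p_commute[of u u' i] i f0 by auto
    moreover have "i \<noteq> 0"
    proof
      assume "i = 0"
      then have "(y, z) \<in> R u'" using i t R_0 by (simp add: tr_iff)
      then show False using y(2) R_unique[of y z u u'] by simp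
    qed
    moreover have "i \<noteq> u'"
    proof
      assume "i = u'"
      then show False using p_neq_0I[of y z u t u u'] y(2) t(2) i b0 by simp
    qed
    ultimately show ?thesis using i by simp
  qed
  then have "insert z (?C z) \<subseteq> ?C y" using xz y by blast
  moreover have "z \<notin> ?C z" using R_unique[of z z u 0] R_0 by auto
  ultimately have "Suc a \<le> a"
    using common[OF xz] common[OF y(1)] card_mono[of "?C y" "insert z (?C z)"]
    by simp
  then show False by simp
qed

text \<open>For f = 0 the valency equations and \<open>master_u\<close> give (b + c)^2 = b^2 + c^2,
  so b or c vanishes. The case b = 0 is excluded; c = 0 would make the classes 0, \<open>u\<close>,
  \<open>u'\<close> closed, although \<open>u\<close> generates.\<close>

lemma f_pos: "f > 0"
proof (rule ccontr)
  assume "\<not> f > 0"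
  then have f0: "f = 0" by simp
  have bc: "b + c = 1 + a" using val_eq_1 val_eq_2 f0 by linarith
  have "b * b + c * c = 1 + 2 * a + a * a" using master_u val_eq_2 f0 by simp
  then have "(b + c) * (b + c) = b * b + c * c" unfolding bc by simp
  then have "b * c = 0" by (simp add: algebra_simps)
  then have c0: "c = 0" using not_f_b_zero[OF f0] by (cases "b = 0") auto
  have "{0, u, u'} = {..d}"
  proof (rule generates_imp_eq_all[OF gen])
    fix j m assume jm: "j \<in> {0, u, u'}" "m \<le> d" "p u j m \<noteq> 0"
    show "m \<in> {0, u, u'}"
    proof (cases "j = 0")
      case True
      then show ?thesis using jm p_0_right[of u m] by (simp split: if_splits)
    next
      case False
      then have "p u u m \<noteq> 0 \<or> p u u' m \<noteq> 0" using jm by auto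
      then have "m \<in> {0, u, u', w, w'}" using p_uu_imp[OF jm(2)] p_uu'_imp[OF jm(2)] by blast
      moreover have "m \<noteq> w" "m \<noteq> w'" using \<open>p u u m \<noteq> 0 \<or> p u u' m \<noteq> 0\<close> f0 c0 by auto
      ultimately show ?thesis by simp
    qed
  qed auto
  then have "w \<in> {0, u, u'}" using w_le by blast
  then show False by simp
qed

section \<open>Solving the equations for the intersection numbers\<close>

lemma valency_sum_L_0:
  fixes F :: "nat \<Rightarrow> nat"
  assumes "(\<Sum>m\<in>L. k m * F m) = 0" "m \<in> L"
  shows "F m = 0"
proof -
  have "k m * F m = 0" using assms sum_eq_0_iff[of L "\<lambda>m. k m * F m"] by blast
  then show ?thesis using valency_pos[of m] assms(2) by simp
qed

lemma params:
  obtains s t :: nat where "b = f + s" "c = f + t" "s + t = 1 + a" "s * t = f * a"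
    "f * h + t * (a + s) = t * g"
    "K * (a + s) = K * (g + h) + (\<Sum>m\<in>L. k m * p w u' m)"
proof -
  define s t :: int where "s = int b - int f" and "t = int c - int f"
  have bc: "int b = int f + s" "int c = int f + t" by (simp_all add: s_def t_def)
  have K: "int K = 1 + 2 * int a + 2 * int f" using val_eq_2 by simp
  have st: "s + t = 1 + int a" using val_eq_1 val_eq_2 by (simp add: s_def t_def)
  have "int b * int b + int c * int c = int K + int a * int a + 2 * int f * int f"
    using arg_cong[OF master_u, of int] by simp
  then have "2 * (int f * (s + t)) + s * s + t * t = 1 + 2 * int a + 2 * int f + int a * int a"
    unfolding bc K by (simp add: algebra_simps)
  then have "s * s + t * t = 1 + 2 * int a + int a * int a - 2 * (int f * int a)"
    unfolding st by (simp add: algebra_simps)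
  moreover have "(s + t) * (s + t) = (1 + int a) * (1 + int a)" using st by simp
  ultimately have prod: "s * t = int f * int a" by (simp add: algebra_simps)
  have nn: "s \<ge> 0 \<and> t \<ge> 0"
  proof (rule ccontr)
    assume "\<not> (s \<ge> 0 \<and> t \<ge> 0)"
    then have "(s < 0 \<and> t > 0) \<or> (t < 0 \<and> s > 0)" using st by linarith
    then have "s * t < 0" by (auto simp: mult_neg_pos mult_pos_neg)
    moreover have "int f * int a \<ge> 0" by simp
    ultimately show False using prod by linarith
  qed
  have "int c * int g = int a * int c + int f * int g + int f * int h"
    using arg_cong[OF master_w, of int] by simp
  then have mw: "int f * int h + t * (int a + s) = t * int g"
    unfolding bc using prod by (simp add: algebra_simps)
  have "int K * int K = int K * (int c + int f + int g + int h) + int (\<Sum>m\<in>L. k m * p w u' m)"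
    using arg_cong[OF row_wu', of int] by (simp only: of_nat_add of_nat_mult)
  moreover have "int K = int a + s + int c + int f" using K st bc by linarith
  then have "int K * int K = int K * (int a + s + int c + int f)" by simp
  ultimately have row: "int K * (int a + s) = int K * (int g + int h) + int (\<Sum>m\<in>L. k m * p w u' m)"
    by (simp add: algebra_simps)
  obtain s' t' where sn: "s = int s'" "t = int t'"
    using nn by (meson nonneg_int_cases)
  show thesis
  proof (rule that[of s' t'])
    show "b = f + s'" "c = f + t'" "s' + t' = 1 + a" using bc st sn by linarith+
    have "int (s' * t') = int (f * a)" using prod sn by simp
    then show "s' * t' = f * a" by (simp only: of_nat_eq_iff)
    have "int (f * h + t' * (a + s')) = int (t' * g)" using mw sn by simp
    then show "f * h + t' * (a + s') = t' * g" by (simp only: of_nat_eq_iff)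
    have "int (K * (a + s')) = int (K * (g + h) + (\<Sum>m\<in>L. k m * p w u' m))"
      using row unfolding sn by (simp only: of_nat_add of_nat_mult)
    then show "K * (a + s') = K * (g + h) + (\<Sum>m\<in>L. k m * p w u' m)" by (simp only: of_nat_eq_iff)
  qed
qed

text \<open>The row sum gives g + h <= a + s. For t > 0 the equation from \<open>master_w\<close>
  gives g >= a + s, so the sum over \<open>L\<close> vanishes. For t = 0 it follows that a = h = 0,
  s = 1 and g is 0 or 1; g = 0 is the exceptional family.\<close>

lemma params_cases:
  obtains (regular) "h = 0" "f + g = a + b" "\<And>m. m \<in> L \<Longrightarrow> p w u' m = 0"
  | (exceptional) "a = 0" "c = f" "b = f + 1" "h = 0" "g = 0" "v = f + 1"
      "(\<Sum>m\<in>L. k m * p w u' m) = K"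
proof -
  obtain s t where st: "b = f + s" "c = f + t" "s + t = 1 + a" "s * t = f * a"
    "f * h + t * (a + s) = t * g"
    "K * (a + s) = K * (g + h) + (\<Sum>m\<in>L. k m * p w u' m)" by (rule params)
  have "K * (g + h) \<le> K * (a + s)" using st(6) by linarith
  then have gh: "g + h \<le> a + s" using K_pos by simp
  have regular': thesis if "h = 0" "g = a + s"
  proof (rule regular)
    show "h = 0" "f + g = a + b" using that st by simp_all
    have "(\<Sum>m\<in>L. k m * p w u' m) = 0" using st(6) that by simp
    then show "p w u' m = 0" if "m \<in> L" for m
      using that by (rule valency_sum_L_0)
  qed
  show thesis
  proof (cases "t = 0")
    case True
    then have "f * a = 0" using st(4) by simp
    then have a: "a = 0" using f_pos by simp
    have "f * h = 0" using True st(5) by simp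
    then have h: "h = 0" using f_pos by simp
    have s: "s = 1" using st(3) True a by simp
    have "g \<le> 1" using gh a s by simp
    then consider "g = 0" | "g = 1" by linarith
    then show thesis
    proof cases
      case 1
      show thesis
      proof (rule exceptional)
        show "a = 0" "c = f" "b = f + 1" "h = 0" "g = 0" using a h s st True 1 by simp_all
        show "(\<Sum>m\<in>L. k m * p w u' m) = K" using st(6) a s 1 h by simp
        have "f * v = f * (f + 1)" using master_w' 1 h st True s by (simp add: algebra_simps)
        then show "v = f + 1" using f_pos by (metis mult_left_cancel less_numeral_extra(3))
      qed
    next
      case 2
      then show thesis using regular' h a s by simp
    qed
  next
    case False
    have "t * (a + s) \<le> t * g" using st(5) by linarith
    then have "a + s \<le> g" using False by simp
    then show thesis using regular' gh by simp
  qed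
qed

text \<open>\<open>master_L\<close> carries the vanishing on \<open>L\<close> from B A^T to A B, and
  transposition carries it to A B^T; so the five classes are stable under multiplication by
  \<open>u\<close>.\<close>

lemma regular_imp_idx:
  assumes "\<And>m. m \<in> L \<Longrightarrow> p w u' m = 0"
  shows "{0, u, u', w, w'} = {..d}"
proof (rule generates_imp_eq_all[OF gen u_le])
  fix j m assume jm: "j \<in> {0, u, u', w, w'}" "m \<le> d" "p u j m \<noteq> 0"
  show "m \<in> {0, u, u', w, w'}"
  proof (rule ccontr)
    assume "m \<notin> {0, u, u', w, w'}"
    then have m: "m \<in> L" using jm(2) by simp
    then have "tr m \<in> L" by (rule tr_L)
    then have 1: "p u w' m = 0" using p_uw'_eq[OF jm(2)] assms by simp
    have "f * p u w m = 0" using master_L[OF m] assms[OF m] assms[OF \<open>tr m \<in> L\<close>] by simp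
    then have 2: "p u w m = 0" using f_pos by simp
    have "p u 0 m = 0" using m p_0_right[of u m] by auto
    then show False using jm 1 2 p_L(1,2)[OF m] by auto
  qed
qed auto

lemma idx_imp_d: "{0, u, u', w, w'} = {..d} \<Longrightarrow> d = 4"
proof -
  assume "{0, u, u', w, w'} = {..d}"
  then have "card {..d} = card {0, u, u', w, w'}" by simp
  also have "\<dots> = 5" by simp
  finally show "d = 4" by simp
qed

text \<open>
  In the exceptional case the scheme is a double cover of a doubly regular tournament: \<open>R e\<close>
  is the graph of the fixed-point-free deck involution, and multiplication by it exchanges
  \<open>A\<close> and \<open>B\<close>.
\<close>

lemma exceptional_structure:
  assumes ex: "a = 0" "c = f" "b = f + 1" "h = 0" "g = 0" "v = f + 1"
      "(\<Sum>m\<in>L. k m * p w u' m) = K"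
  obtains e where "e \<in> L" "tr e = e" "k e = 1" "{..d} = {0, u, u', w, w', e}"
    "\<And>m. m \<le> d \<Longrightarrow> p u e m = (if m = w then 1 else 0)"
proof -
  have K: "K = 2 * f + 1" using val_eq_2 ex by simp
  \<comment> \<open>The classes outside \<open>L\<close> already exhaust the row sum of A B.\<close>
  have "K * K = K * (f + g + v) + (\<Sum>m\<in>L. k m * p u w m)" by (rule row_uw)
  moreover have "f + g + v = K" using ex K by simp
  ultimately have "(\<Sum>m\<in>L. k m * p u w m) = 0" by simp
  then have q: "p u w m = 0" if "m \<in> L" for m using that by (rule valency_sum_L_0)
  have sym: "p w u' (tr m) = p w u' m" if m: "m \<in> L" for m
  proof -
    have "f * p w u' m = f * p w u' (tr m)" using master_L[OF m] q[OF m] ex by simp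
    then show ?thesis using f_pos by simp
  qed
  have "\<exists>e\<in>L. p w u' e \<noteq> 0"
    using ex(7) K_pos by (metis (no_types, lifting) mult_0_right sum.neutral less_numeral_extra(3))
  then obtain e where e: "e \<in> L" "p w u' e \<noteq> 0" by blast
  \<comment> \<open>Comparing (A B) A^T with A (B A^T) shows that a class \<open>i\<close> of
    \<open>L\<close> occurring in B A^T multiplies \<open>u\<close> into \<open>w\<close> alone. Row
    sums then give it the coefficient \<open>K\<close>, so the total weight \<open>K\<close> leaves
    room for one such class, of valency 1.\<close>
  have main: "K * p u i w = K * k i \<and> p w u' i = K \<and> (\<forall>m\<le>d. m \<noteq> w \<longrightarrow> p u i m = 0)"
    if i: "i \<in> L" "p w u' i \<noteq> 0" for i
  proof -
    have z: "p u i m = 0" if m: "m \<le> d" "m \<noteq> w" for m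
    proof -
      have A: "p u w u * p u u' m + p u w u' * p u' u' m + p u w w * p w u' m + p u w w' * p w' u' m
           = p w u' u * p u u m + p w u' u' * p u u' m + p w u' w * p u w m + p w u' w' * p u w' m
             + (\<Sum>e\<in>L. p w u' e * p u e m)"
        using p_assoc[of u w u' m] m(1) q unfolding sum_idx_split by simp
      have B: "p w' u' m = p u w (tr m)"
        using p_tr[of w' u' m] m(1) p_commute[of w u "tr m"] by simp
      have A': "f * p u u' m + (f + 1) * p u w (tr m)
          = f * p u u m + f * p u u' m + (\<Sum>e\<in>L. p w u' e * p u e m)"
        using A ex B by simp
      have C: "(f + 1) * p u w (tr m) = f * p u u m"
      proof -
        consider "m = 0" | "m = u" | "m = u'" | "m = w'" | "m \<in> L" using m by auto
        then show ?thesis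
        proof cases
          case 5
          then show ?thesis using q[OF tr_L[OF 5]] by simp
        qed (use ex in simp_all)
      qed
      have "(\<Sum>e\<in>L. p w u' e * p u e m) = 0" using A' C by simp
      then have "p w u' i * p u i m = 0" using i(1) by (subst (asm) sum_eq_0_iff) auto
      then show ?thesis using i(2) by simp
    qed
    have "(\<Sum>l\<le>d. k l * p u i l) = (\<Sum>l\<le>d. if l = w then K * p u i w else 0)"
      using z by (intro sum.cong) auto
    then have 1: "K * p u i w = K * k i" using p_row_sum[of u i] i by simp
    then have "p u i w = k i" using K_pos by simp
    then have "p i u w = k i" using p_commute[of u i w] i by simp
    then have "K * k i = k i * p w u' i" using p_upper_exchange[of i u w] i(1) by simp
    then have "k i * p w u' i = k i * K" by (metis mult.commute)
    then have "p w u' i = K" using valency_pos[of i] i(1) by (metis mult_left_cancel less_numeral_extra(3) DiffD1 atMost_iff)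
    then show ?thesis using 1 z by blast
  qed
  have pe: "p w u' e = K" using main[OF e] by blast
  have single: "k e = 1 \<and> (\<forall>m\<in>L. m \<noteq> e \<longrightarrow> p w u' m = 0)"
  proof -
    have "(\<Sum>m\<in>L. k m * p w u' m) = k e * p w u' e + (\<Sum>m\<in>L - {e}. k m * p w u' m)"
      using e(1) by (intro sum.remove) auto
    then have eq: "K = k e * K + (\<Sum>m\<in>L - {e}. k m * p w u' m)" using ex(7) pe by simp
    moreover have "k e \<ge> 1" using valency_pos[of e] e by simp
    then have "k e * K \<ge> K" by simp
    ultimately have "k e * K = K" "(\<Sum>m\<in>L - {e}. k m * p w u' m) = 0" by linarith+
    then have "k e = 1" "\<forall>m\<in>L - {e}. k m * p w u' m = 0" using K_pos by auto
    moreover have "k m \<noteq> 0" if "m \<in> L" for m using that valency_pos[of m] by auto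
    ultimately show ?thesis by (metis DiffI insertE empty_iff mult_eq_0_iff)
  qed
  have tre: "tr e = e"
  proof (rule ccontr)
    assume "tr e \<noteq> e"
    then have "p w u' (tr e) = 0" using single tr_L[OF e(1)] by blast
    then show False using sym[OF e(1)] e(2) by simp
  qed
  have "{0, u, u', w, w', e} = {..d}"
  proof (rule generates_imp_eq_all[OF gen u_le])
    show "{0, u, u', w, w', e} \<subseteq> {..d}" using e(1) by auto
    show "tr i \<in> {0, u, u', w, w', e}" if "i \<in> {0, u, u', w, w', e}" for i
      using that tre by auto
    fix j m assume jm: "j \<in> {0, u, u', w, w', e}" "m \<le> d" "p u j m \<noteq> 0"
    show "m \<in> {0, u, u', w, w', e}"
    proof (rule ccontr)
      assume "m \<notin> {0, u, u', w, w', e}"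
      then have m: "m \<in> L" "m \<noteq> e" "m \<noteq> w" using jm(2) by auto
      have "tr m \<noteq> e" using m(2) tre jm(2) tr_tr[of m] by metis
      then have "p u w' m = 0" using p_uw'_eq[OF jm(2)] single tr_L[OF m(1)] by simp
      moreover have "p u 0 m = 0" using m p_0_right[of u m] by auto
      moreover have "p u e m = 0" using main[OF e] jm(2) m(3) by blast
      ultimately show False using jm(1,3) q[OF m(1)] p_L(1,2)[OF m(1)] by auto
    qed
  qed auto
  moreover have "p u e m = (if m = w then 1 else 0)" if "m \<le> d" for m
    using main[OF e] that single K_pos by auto
  ultimately show thesis using that e(1) tre single by metis
qed

lemma not_exceptional:
  assumes ex: "a = 0" "c = f" "b = f + 1" "h = 0" "g = 0" "v = f + 1"
      "(\<Sum>m\<in>L. k m * p w u' m) = K"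
  shows False
proof -
  have K: "K = 2 * f + 1" using val_eq_2 ex by simp
  obtain e where e: "e \<in> L" "tr e = e" "k e = 1" and idx: "{..d} = {0, u, u', w, w', e}"
    and pe: "\<And>m. m \<le> d \<Longrightarrow> p u e m = (if m = w then 1 else 0)"
    using exceptional_structure[OF ex] by metis
  have ed: "e \<le> d" and dist: "e \<noteq> 0" "e \<noteq> u" "e \<noteq> u'" "e \<noteq> w" "e \<noteq> w'" using e(1) by auto
  have cases_d: "l = 0 \<or> l = u \<or> l = u' \<or> l = w \<or> l = w' \<or> l = e" if "l \<le> d" for l
  proof -
    have "l \<in> {0, u, u', w, w', e}" using that unfolding idx[symmetric] by simp
    then show ?thesis by simp
  qed
  have pe': "p u' e m = (if m = w' then 1 else 0)" if "m \<le> d" for m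
    using p_tr[of u' e m] pe[of "tr m"] tr_inj[of m w'] e(2) ed that by simp
  have pee: "p e e m = (if m = 0 then 1 else 0)" if "m \<le> d" for m
  proof -
    have 0: "p e e 0 = 1" using p_0_upper[of e e] e ed by simp
    have "(\<Sum>l\<le>d. k l * p e e l) = k 0 * p e e 0 + (\<Sum>l\<in>{..d} - {0}. k l * p e e l)"
      by (intro sum.remove) auto
    then have "(\<Sum>l\<in>{..d} - {0}. k l * p e e l) = 0" using p_row_sum[OF ed ed] e 0 by simp
    then have "k m * p e e m = 0" if "m \<noteq> 0"
      using that \<open>m \<le> d\<close> sum_eq_0_iff[of "{..d} - {0}" "\<lambda>l. k l * p e e l"] by blast
    then show ?thesis using 0 valency_pos[OF that] by auto
  qed
  define S V s where "S = A u + A u'" and "V = A w + A w'" and "s = A e"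
  have prod: "A i ** A j = N" if "i \<le> d" "j \<le> d"
    "\<And>x y l. l \<le> d \<Longrightarrow> (x, y) \<in> R l \<Longrightarrow> of_nat (p i j l) = N $ x $ y" for i j N
    using that by (intro scheme_matrix_eqI) (simp add: A_mult_nth)
  have ss: "s ** s = mat 1" unfolding s_def
    by (rule prod[OF ed ed]) (auto simp: A_0[symmetric] A_nth pee)
  have As: "A u ** s = A w" unfolding s_def
    by (rule prod[OF u_le ed]) (auto simp: A_nth pe)
  have Ts: "A u' ** s = A w'" unfolding s_def
    by (rule prod[OF _ ed]) (auto simp: A_nth pe')
  have sA: "s ** A u = A w" unfolding s_def
    by (rule prod[OF ed u_le]) (auto simp: A_nth pe p_commute[OF ed])
  have sT: "s ** A u' = A w'" unfolding s_def
    by (rule prod[OF ed]) (auto simp: A_nth pe' p_commute[OF ed])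
  have AA: "A u ** A u = of_nat (f + 1) *\<^sub>m A u' + of_nat f *\<^sub>m A w"
    by (rule prod[OF u_le u_le]) (auto simp: A_nth ex(1-6) p_L[OF e(1)] dist dest!: cases_d)
  have TT: "A u' ** A u' = of_nat (f + 1) *\<^sub>m A u + of_nat f *\<^sub>m A w'"
    by (rule prod) (auto simp: A_nth ex(1-6) p_L[OF e(1)] dist dest!: cases_d)
  have AT: "A u ** A u' = of_nat K *\<^sub>m mat 1 + of_nat f *\<^sub>m V" unfolding V_def A_0[symmetric]
    by (rule prod) (auto simp: A_nth ex(1-6) p_L[OF e(1)] dist dest!: cases_d)
  have TA: "A u' ** A u = of_nat K *\<^sub>m mat 1 + of_nat f *\<^sub>m V" unfolding V_def A_0[symmetric]
    by (rule prod) (auto simp: A_nth ex(1-6) p_L[OF e(1)] dist p_commute[of u' u] dest!: cases_d)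
  have Ss: "S ** s = V" "s ** S = V" by (simp_all add: S_def V_def cscale_simps As Ts sA sT)
  have Vs: "V ** s = S" "s ** V = S"
    by (metis Ss(1) ss matrix_mul_assoc matrix_mul_rid) (metis Ss(2) ss matrix_mul_assoc matrix_mul_lid)
  have SS: "S ** S = of_nat (2 * K) *\<^sub>m mat 1 + of_nat (f + 1) *\<^sub>m S + of_nat (3 * f) *\<^sub>m V"
    unfolding S_def
    by (simp add: cscale_simps AA TT AT TA) (simp add: vec_eq_iff V_def algebra_simps)
  have SV: "S ** V = of_nat (2 * K) *\<^sub>m s + of_nat (f + 1) *\<^sub>m V + of_nat (3 * f) *\<^sub>m S"
    unfolding Ss(1)[symmetric] matrix_mul_assoc SS by (simp add: cscale_simps Ss Vs)
  have "V ** S = s ** (S ** S)" unfolding Ss(2)[symmetric] by (rule matrix_mul_assoc[symmetric])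
  then have VS: "V ** S = S ** V" unfolding SS SV by (simp add: cscale_simps Ss Vs)
  have VV: "V ** V = S ** S"
    using Ss Vs ss by (metis matrix_mul_assoc)
  define n where "n = CARD('a)"
  have n: "n = 4 * K + 2"
    unfolding n_def card_points idx using dist e by simp
  \<comment> \<open>The projection onto the eigenvalue \<open>1\<close> of \<open>A\<close> inside the \<open>-1\<close>-eigenspace of \<open>s\<close>; its
    trace \<open>K(2K + 1)/(K + 2)\<close> is not an integer.\<close>
  define E where "E = (1 / of_nat (2 * (K + 2))) *\<^sub>m (S - V + of_nat K *\<^sub>m (mat 1 - s))"
  have "E ** E = E"
    unfolding E_def cscale_simps SS SV VS VV Ss Vs ss matrix_mul_lid matrix_mul_rid K
    by (rule matrix_eqI) (simp add: divide_simps, simp add: algebra_simps)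
  then have "trace E = of_nat (rank E)" by (rule trace_idempotent_eq_rank)
  moreover have "trace E = of_nat (K * n) / of_nat (2 * (K + 2))"
    unfolding E_def trace_simps S_def V_def s_def n_def
    using ed dist by (simp add: trace_A)
  moreover have "(of_nat (2 * (K + 2)) :: complex) \<noteq> 0"
    unfolding of_nat_eq_0_iff by simp
  ultimately have "of_nat (K * n) = (of_nat (rank E * (2 * (K + 2))) :: complex)"
    by (metis nonzero_divide_eq_eq of_nat_mult)
  then have "K * n = rank E * (2 * (K + 2))" by (simp only: of_nat_eq_iff)
  then have "2 * (K + 2) dvd K * (4 * K + 2)" unfolding n by (metis dvd_triv_right)
  moreover have "K * (4 * K + 2) = 2 * (K * (2 * K + 1))" by (simp add: algebra_simps)
  ultimately have "2 * (K + 2) dvd 2 * (K * (2 * K + 1))" by (simp only:)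
  have two: "(2 :: nat) \<noteq> 0" by simp
  from \<open>2 * (K + 2) dvd 2 * (K * (2 * K + 1))\<close>
  have "K + 2 dvd K * (2 * K + 1)"
    using dvd_times_left_cancel_iff[OF two, of "K + 2" "K * (2 * K + 1)"] by (simp only:)
  then have "int (K + 2) dvd int (K * (2 * K + 1))" by (simp only: of_nat_dvd_iff)
  then have "int K + 2 dvd int K * (2 * int K + 1)" by (simp add: algebra_simps)
  \<comment> \<open>The remainder 6 is the value at K = -2. As K = 2f + 1 >= 3, the bound K + 2 <= 6
    leaves K = 3, and 5 does not divide 6.\<close>
  moreover have "int K * (2 * int K + 1) = (int K + 2) * (2 * int K - 3) + 6" by (simp add: algebra_simps)
  ultimately have "int K + 2 dvd 6" by (metis dvd_add_right_iff dvd_triv_left)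
  then have "int K + 2 \<le> 6" by (rule zdvd_imp_le) simp
  then have "f = 1" using K f_pos by simp
  then show False using \<open>int K + 2 dvd 6\<close> K by simp
qed

lemma regular_params: "{0, u, u', w, w'} = {..d}" "h = 0" "f + g = a + b"
proof -
  have r: "(\<forall>m\<in>L. p w u' m = 0) \<and> h = 0 \<and> f + g = a + b"
    by (rule params_cases) (use not_exceptional in blast)+
  then show "{0, u, u', w, w'} = {..d}" "h = 0" "f + g = a + b"
    using regular_imp_idx by blast+
qed

lemma idx_cases: "l \<le> d \<Longrightarrow> l = 0 \<or> l = u \<or> l = u' \<or> l = w \<or> l = w'"
proof -
  assume "l \<le> d"
  then have "l \<in> {0, u, u', w, w'}" unfolding regular_params(1) by simp
  then show ?thesis by simp
qed

section \<open>Matrix relations and primitive idempotents of the four-class scheme\<close>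

lemma n_eq: "CARD('a) = 1 + 4 * K"
  unfolding card_points regular_params(1)[symmetric] by simp

lemma all_ones_eq: "all_ones = mat 1 + A u + A u' + A w + A w'"
  unfolding A_0[symmetric]
  by (rule scheme_matrix_eqI) (auto simp: all_ones_def A_nth dest!: idx_cases)

lemma all_ones_sq: "all_ones ** all_ones = (1 + 4 * of_nat K) *\<^sub>m (all_ones :: complex^'a^'a)"
  by (simp add: vec_eq_iff matrix_matrix_mult_def all_ones_def n_eq)

lemma A_products:
  "A u ** A u = of_nat a *\<^sub>m A u + of_nat b *\<^sub>m A u' + of_nat c *\<^sub>m A w"
  "A u' ** A u' = of_nat b *\<^sub>m A u + of_nat a *\<^sub>m A u' + of_nat c *\<^sub>m A w'"
  "A u ** A u' = of_nat K *\<^sub>m mat 1 + of_nat a *\<^sub>m (A u + A u') + of_nat f *\<^sub>m (A w + A w')"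
  "A u' ** A u = of_nat K *\<^sub>m mat 1 + of_nat a *\<^sub>m (A u + A u') + of_nat f *\<^sub>m (A w + A w')"
  unfolding A_0[symmetric]
  by (rule scheme_matrix_eqI, auto simp: A_mult_nth A_nth p_commute[of u' u] dest!: idx_cases)+

lemma c_pos: "c > 0"
proof -
  obtain s t where "c = f + t" by (rule params)
  then show ?thesis using f_pos by simp
qed

text \<open>
  On the range of \<open>F\<close> the matrix \<open>A u\<close> satisfies \<open>(x - \<theta>)(x - \<theta>') = 0\<close>, and \<open>E\<close> projects onto
  the \<open>\<theta>\<close>-eigenspace. On \<open>E\<close> every element of the algebra acts as a scalar, so \<open>E\<close> is
  primitive unless it vanishes.
\<close>

lemma half_idempotent:
  fixes F E :: "complex^'a^'a" and \<sigma> \<theta> \<theta>' :: complex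
  assumes F: "F ** F = F" "A u ** F = F ** A u" "F ** all_ones = 0"
    and FT: "F ** A u' = \<sigma> *\<^sub>m F - F ** A u"
    and FAA: "F ** A u ** A u = \<sigma> *\<^sub>m (F ** A u) - (\<theta> * \<theta>') *\<^sub>m F"
    and \<theta>: "\<theta> + \<theta>' = \<sigma>" "\<theta> \<noteq> \<theta>'"
    and BM: "F \<in> BM" "F ** A u \<in> BM"
    and E: "E = (1 / (\<theta> - \<theta>')) *\<^sub>m (F ** A u - \<theta>' *\<^sub>m F)"
    and m: "\<And>E. primitive_idempotent BM E \<Longrightarrow> E \<noteq> trivial_idempotent \<Longrightarrow> rank E = m"
  shows "trace E = (if E = 0 then 0 else of_nat m)"
proof (cases "E = 0")
  case True
  then show ?thesis by (simp add: trace_def)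
next
  case False
  have EF: "E ** F = E"
    unfolding E cscale_simps matrix_mul_assoc[symmetric] F(2)
    by (simp add: matrix_mul_assoc F(1))
  have EA: "E ** A u = \<theta> *\<^sub>m E"
    unfolding E cscale_simps FAA \<theta>(1)[symmetric] by (simp add: vec_eq_iff algebra_simps)
  have ET: "E ** A u' = \<theta>' *\<^sub>m E"
  proof -
    have "E ** F ** A u' = \<sigma> *\<^sub>m (E ** F) - E ** F ** A u"
      by (simp add: matrix_mul_assoc[symmetric] FT cscale_simps)
    then show ?thesis unfolding EF EA \<theta>(1)[symmetric] by (simp add: vec_eq_iff algebra_simps)
  qed
  have EJ: "E ** all_ones = 0"
  proof -
    have "E ** all_ones = E ** (F ** all_ones)" by (simp only: matrix_mul_assoc EF)
    then show ?thesis using F(3) by (simp add: vec_eq_iff matrix_matrix_mult_def)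
  qed
  have EE: "E ** E = E"
  proof -
    have "E ** E = (1 / (\<theta> - \<theta>')) *\<^sub>m (E ** F ** A u - \<theta>' *\<^sub>m (E ** F))"
      by (subst (2) E) (simp add: cscale_simps matrix_mul_assoc)
    also have "\<dots> = E" unfolding EF EA
      using \<theta>(2) by (intro matrix_eqI) (simp add: left_diff_distrib[symmetric])
    finally show ?thesis .
  qed
  \<comment> \<open>Obtained by applying \<open>E\<close> to A^2 = aA + bA^T + cB and solving for B,
    as c > 0. The scalar for B^T then follows from \<open>E ** all_ones = 0\<close>.\<close>
  define \<beta> where "\<beta> = (\<theta> * \<theta> - of_nat a * \<theta> - of_nat b * \<theta>') / of_nat c"
  have EB: "E ** A w = \<beta> *\<^sub>m E"
  proof -
    have "E ** (A u ** A u) = (\<theta> * \<theta>) *\<^sub>m E" by (simp add: matrix_mul_assoc EA cscale_simps)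
    moreover have "E ** (A u ** A u) = of_nat a *\<^sub>m \<theta> *\<^sub>m E + of_nat b *\<^sub>m \<theta>' *\<^sub>m E + of_nat c *\<^sub>m (E ** A w)"
      unfolding A_products cscale_simps EA ET ..
    ultimately show ?thesis using c_pos
      by (simp add: vec_eq_iff \<beta>_def divide_simps) (simp add: algebra_simps)
  qed
  have EB': "E ** A w' = (- 1 - \<sigma> - \<beta>) *\<^sub>m E"
  proof (rule matrix_eqI)
    fix x y
    let ?e = "E $ x $ y"
    have "0 = ?e + \<theta> * ?e + \<theta>' * ?e + \<beta> * ?e + (E ** A w') $ x $ y"
      using arg_cong[OF EJ, of "\<lambda>M. M $ x $ y"]
      unfolding all_ones_eq cscale_simps EA ET EB by simp
    then have "(E ** A w') $ x $ y = 0 - (?e + \<theta> * ?e + \<theta>' * ?e + \<beta> * ?e)" by (metis add_diff_cancel_left')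
    then show "(E ** A w') $ x $ y = ((- 1 - \<sigma> - \<beta>) *\<^sub>m E) $ x $ y"
      by (simp add: \<theta>(1)[symmetric] algebra_simps)
  qed
  have "\<exists>l. E ** A i = l *\<^sub>m E" if "i \<le> d" for i
  proof -
    have "E ** A 0 = 1 *\<^sub>m E" by (simp add: A_0 vec_eq_iff)
    then show ?thesis using idx_cases[OF that] EA ET EB EB' by blast
  qed
  moreover have "E \<in> BM" unfolding E by (intro BM_cscale BM_diff BM)
  ultimately have "primitive_idempotent BM E"
    using False EE by (intro eigen_imp_primitive_idempotent) auto
  moreover have "E \<noteq> trivial_idempotent"
  proof
    assume "E = trivial_idempotent"
    then have "(E ** all_ones) $ undefined $ undefined = (1 :: complex)"
      by (simp add: trivial_idempotent_def all_ones_def matrix_matrix_mult_def)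
    then show False using EJ by simp
  qed
  ultimately have "rank E = m" by (rule m)
  then show ?thesis using trace_idempotent_eq_rank[OF EE] False by simp
qed

subsection \<open>Pseudocyclic parameters\<close>

text \<open>
  \<open>\<sigma>\<close> and \<open>\<tau>\<close> are the eigenvalues other than \<open>2K\<close> of \<open>S = A u + A u'\<close>, and \<open>F\<close> projects onto the
  \<open>\<sigma>\<close>-eigenspace orthogonal to the all-ones vector. It is the sum of \<open>r\<close> primitive idempotents.
\<close>

lemma eigenspace_trace:
  fixes \<sigma> \<tau> :: real
  assumes sum: "\<sigma> + \<tau> = 3 * real a + real b - real c - 2 * real f"
    and prod: "\<sigma> * \<tau> = real c + 2 * real f - 2 * real K"
    and ne: "\<sigma> \<noteq> \<tau>"
    and m: "\<And>E. primitive_idempotent BM E \<Longrightarrow> E \<noteq> trivial_idempotent \<Longrightarrow> rank E = m"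
  obtains r :: nat where "r = 1 \<or> r = 2" "- 4 * real K * \<tau> - 2 * real K = real (r * m) * (\<sigma> - \<tau>)"
proof -
  define S V where "S = A u + A u'" and "V = A w + A w'"
  \<comment> \<open>Chosen so that \<open>F\<close> annihilates \<open>all_ones\<close>: the row
    sums of S - \<tau> I are 2K - \<tau>, and there are 1 + 4K points.\<close>
  define \<rho> where "\<rho> = (2 * real K - \<tau>) / (1 + 4 * real K)"
  define \<kappa> where "\<kappa> = real c + 2 * real f"
  define al where "al = 1 / (\<sigma> - \<tau>)"
  define F where "F = of_real al *\<^sub>m (S - of_real \<tau> *\<^sub>m mat 1 - of_real \<rho> *\<^sub>m all_ones)"
  have n: "1 + 4 * real K \<noteq> 0" by linarith
  have rn: "\<rho> * (1 + 4 * real K) = 2 * real K - \<tau>" using n by (simp add: \<rho>_def)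
  have vals: "real K = real a + real b + real c" "real K = 1 + 2 * real a + 2 * real f"
    using val_eq_1 val_eq_2 by linarith+
  \<comment> \<open>The quadratic equation of \<open>S\<close> evaluated on the all-ones vector,
    where \<open>S\<close> has eigenvalue 2K.\<close>
  have "(2 * real K - \<tau>) * (2 * real K - \<sigma>) = \<kappa> * (1 + 4 * real K)"
  proof -
    have "(2 * real K - \<tau>) * (2 * real K - \<sigma>) = 4 * real K * real K - 2 * real K * (\<sigma> + \<tau>) + \<sigma> * \<tau>"
      by (simp add: algebra_simps)
    also have "\<dots> = 2 * real K * (2 * real K - (3 * real a + real b - \<kappa>) - 1) + \<kappa>"
      unfolding sum prod \<kappa>_def by (simp add: algebra_simps)
    also have "2 * real K - (3 * real a + real b - \<kappa>) - 1 = 2 * \<kappa>"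
      unfolding \<kappa>_def using vals by algebra
    finally show ?thesis by (simp add: algebra_simps)
  qed
  then have rk: "\<rho> * (2 * real K - \<sigma>) = \<kappa>" using n by (simp add: \<rho>_def divide_simps)
  have V: "V = all_ones - mat 1 - S" unfolding all_ones_eq S_def V_def by simp
  have SS: "S ** S = of_real (\<sigma> + \<tau>) *\<^sub>m S - of_real (\<sigma> * \<tau>) *\<^sub>m mat 1 + of_real \<kappa> *\<^sub>m all_ones"
  proof -
    have "S ** S = of_nat (2 * K) *\<^sub>m mat 1 + of_nat (3 * a + b) *\<^sub>m S + of_nat (c + 2 * f) *\<^sub>m V"
      unfolding S_def V_def cscale_simps A_products by (simp add: vec_eq_iff algebra_simps)
    then show ?thesis unfolding V sum prod \<kappa>_def by (simp add: vec_eq_iff algebra_simps)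
  qed
  have SJ: "S ** all_ones = of_real (2 * real K) *\<^sub>m all_ones" "all_ones ** S = of_real (2 * real K) *\<^sub>m all_ones"
    unfolding S_def by (simp_all add: cscale_simps A_row A_col vec_eq_iff)
  have JJ: "all_ones ** all_ones = of_real (1 + 4 * real K) *\<^sub>m (all_ones :: complex^'a^'a)"
    unfolding all_ones_sq by simp
  have FJ: "F ** all_ones = 0"
  proof -
    have "F ** all_ones = of_real (al * (2 * real K - \<tau> - \<rho> * (1 + 4 * real K))) *\<^sub>m all_ones"
      unfolding F_def cscale_simps SJ JJ by (simp add: vec_eq_iff algebra_simps)
    then show ?thesis unfolding rn by (simp add: vec_eq_iff)
  qed
  have FS: "F ** S = of_real \<sigma> *\<^sub>m F"
  proof -
    have "of_real \<rho> * (of_real (2 * real K - \<sigma>) :: complex) = of_real \<kappa>"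
      unfolding of_real_mult[symmetric] rk ..
    then show ?thesis
      unfolding F_def cscale_simps SJ SS matrix_mul_lid
      by (simp add: vec_eq_iff algebra_simps)
  qed
  have FF: "F ** F = F"
  proof -
    have "F ** F = of_real al *\<^sub>m (F ** S - of_real \<tau> *\<^sub>m F)"
      by (subst (2) F_def) (simp add: cscale_simps FJ, simp add: vec_eq_iff)
    also have "\<dots> = of_real (al * (\<sigma> - \<tau>)) *\<^sub>m F"
      unfolding FS by (simp add: vec_eq_iff algebra_simps)
    also have "al * (\<sigma> - \<tau>) = 1" using ne by (simp add: al_def)
    finally show ?thesis by (simp add: vec_eq_iff)
  qed
  have AF: "A u ** F = F ** A u"
    unfolding F_def S_def cscale_simps A_products by (simp add: A_row A_col)
  have FT: "F ** A u' = of_real \<sigma> *\<^sub>m F - F ** A u"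
    unfolding FS[symmetric] S_def cscale_simps by simp
  \<comment> \<open>The scalar by which A A^T acts on \<open>F\<close>, where \<open>V\<close> acts
    as -1 - \<sigma>. Since A + A^T acts as \<sigma>, A is there a root of x^2 - \<sigma> x +
    N.\<close>
  define N :: complex where "N = of_real (real K + real a * \<sigma> - real f - real f * \<sigma>)"
  have FAA: "F ** A u ** A u = of_real \<sigma> *\<^sub>m (F ** A u) - N *\<^sub>m F"
  proof -
    have "F ** A u ** S = A u ** (F ** S)" unfolding AF[symmetric] by (rule matrix_mul_assoc[symmetric])
    then have 1: "F ** A u ** S = of_real \<sigma> *\<^sub>m (F ** A u)" unfolding FS by (simp add: cscale_simps AF)
    have FV: "F ** V = - (1 + of_real \<sigma>) *\<^sub>m F"
      unfolding V cscale_simps FJ FS by (simp add: vec_eq_iff algebra_simps)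
    have "F ** (A u ** A u') = N *\<^sub>m F"
      unfolding A_products S_def[symmetric] V_def[symmetric] cscale_simps FS FV N_def
      by (simp add: vec_eq_iff algebra_simps)
    then have "F ** A u ** A u' = N *\<^sub>m F" by (simp add: matrix_mul_assoc)
    then have "F ** A u ** S = F ** A u ** A u + N *\<^sub>m F" by (simp add: S_def cscale_simps)
    then show ?thesis unfolding 1 by simp
  qed
  have FA_exp: "F ** A u = of_real al *\<^sub>m (A u ** A u + A u' ** A u - of_real \<tau> *\<^sub>m A u
      - of_real (\<rho> * real K) *\<^sub>m all_ones)"
    unfolding F_def S_def cscale_simps by (simp add: A_col vec_eq_iff)
  have bmJ: "all_ones \<in> BM"
    unfolding all_ones_eq A_0[symmetric] by (intro BM_add BM_A) simp_all
  have bm: "F \<in> BM" "F ** A u \<in> BM"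
    unfolding FA_exp A_products unfolding F_def S_def A_0[symmetric]
    by (intro BM_add BM_diff BM_cscale BM_A bmJ; simp)+
  \<comment> \<open>Otherwise \<open>(A u - A u') F\<close> is a nonzero real skew-symmetric matrix with square \<open>0\<close>.\<close>
  have disc: "of_real \<sigma> * of_real \<sigma> \<noteq> 4 * N"
  proof
    assume 0: "of_real \<sigma> * of_real \<sigma> = 4 * N"
    define M where "M = F ** A u - F ** A u'"
    have FAF: "F ** A u ** F = F ** A u"
      unfolding matrix_mul_assoc[symmetric] AF by (simp add: matrix_mul_assoc FF)
    have FFA: "F ** (F ** A u) = F ** A u" by (simp add: matrix_mul_assoc FF)
    have FAFA: "F ** A u ** (F ** A u) = F ** A u ** A u" by (simp add: matrix_mul_assoc FAF)
    have M2: "M = 2 *\<^sub>m (F ** A u) - of_real \<sigma> *\<^sub>m F"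
      unfolding M_def FT by (simp add: vec_eq_iff)
    have "M ** M = (of_real \<sigma> * of_real \<sigma> - 4 * N) *\<^sub>m F"
      unfolding M2 cscale_simps FAFA FAF FFA FF FAA by (simp add: vec_eq_iff algebra_simps)
    then have MM: "M ** M = 0" unfolding 0 by (simp add: vec_eq_iff)
    define t where "t x z = al * ((real a - real b - \<tau>) *
      ((if (x, z) \<in> R u then 1 else 0) - (if (z, x) \<in> R u then 1 else 0)) + real c *
      ((if (x, z) \<in> R w then 1 else 0) - (if (z, x) \<in> R w then 1 else 0)))" for x z
    have "M = of_real al *\<^sub>m (of_real (real a - real b - \<tau>) *\<^sub>m (A u - A u') + of_nat c *\<^sub>m (A w - A w'))"
      unfolding M_def F_def S_def cscale_simps A_products
      by (simp add: A_col vec_eq_iff algebra_simps)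
    then have Mt: "M $ x $ z = of_real (t x z)" for x z
      by (simp add: t_def adj_matrix_def tr_iff)
    have skew: "t z x = - t x z" for x z by (simp add: t_def algebra_simps)
    have "(M ** M) $ x $ x = of_real (- (\<Sum>z\<in>UNIV. t x z * t x z))" for x
      unfolding matrix_matrix_mult_def by (simp add: Mt skew[of _ x] sum_negf)
    then have "(\<Sum>z\<in>UNIV. t x z * t x z) = 0" for x using MM by (metis neg_equal_0_iff_equal of_real_eq_0_iff zero_index)
    then have t0: "t x z = 0" for x z by (simp add: sum_nonneg_eq_0_iff)
    obtain x z where "(x, z) \<in> R w" using R_nonempty[OF w_le] by blast
    then have "(z, x) \<notin> R w" "(x, z) \<notin> R u" "(z, x) \<notin> R u"
      using R_unique[of x z w u] R_unique[of x z w w'] R_unique[of x z w u'] by (auto simp: tr_iff)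
    then have "t x z = al * real c" using \<open>(x, z) \<in> R w\<close> by (simp add: t_def)
    then show False using t0[of x z] c_pos ne by (simp add: al_def)
  qed
  define \<delta> where "\<delta> = csqrt (of_real \<sigma> * of_real \<sigma> - 4 * N)"
  define \<theta> \<theta>' where "\<theta> = (of_real \<sigma> + \<delta>) / 2" and "\<theta>' = (of_real \<sigma> - \<delta>) / 2"
  have d2: "\<delta> * \<delta> = of_real \<sigma> * of_real \<sigma> - 4 * N" unfolding \<delta>_def by (metis power2_csqrt power2_eq_square)
  have th: "\<theta> + \<theta>' = of_real \<sigma>" "\<theta> \<noteq> \<theta>'" "\<theta> * \<theta>' = N"
  proof -
    show "\<theta> + \<theta>' = of_real \<sigma>" by (simp add: \<theta>_def \<theta>'_def field_simps)
    show "\<theta> \<noteq> \<theta>'" using disc d2 by (auto simp: \<theta>_def \<theta>'_def)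
    have "\<theta> * \<theta>' = (of_real \<sigma> * of_real \<sigma> - \<delta> * \<delta>) / 4" by (simp add: \<theta>_def \<theta>'_def field_simps)
    then show "\<theta> * \<theta>' = N" unfolding d2 by simp
  qed
  define E1 E2 where "E1 = (1 / (\<theta> - \<theta>')) *\<^sub>m (F ** A u - \<theta>' *\<^sub>m F)"
    and "E2 = (1 / (\<theta>' - \<theta>)) *\<^sub>m (F ** A u - \<theta> *\<^sub>m F)"
  have t1: "trace E1 = (if E1 = 0 then 0 else of_nat m)"
    by (rule half_idempotent[OF FF AF FJ FT _ th(1,2) bm E1_def m]) (simp_all add: FAA th(3))
  have t2: "trace E2 = (if E2 = 0 then 0 else of_nat m)"
    using th(1,2) by (intro half_idempotent[OF FF AF FJ FT _ _ _ bm E2_def m]) (simp_all add: FAA th(3) mult.commute[of \<theta>'] add.commute)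
  have E12: "E1 + E2 = F"
  proof (rule matrix_eqI)
    fix x y
    have 1: "1 / (\<theta>' - \<theta>) = - (1 / (\<theta> - \<theta>'))" by (metis minus_diff_eq minus_divide_right)
    have "(E1 + E2) $ x $ y = (\<theta> - \<theta>') * F $ x $ y / (\<theta> - \<theta>')"
      unfolding E1_def E2_def 1 by (simp add: diff_divide_distrib algebra_simps)
    then show "(E1 + E2) $ x $ y = F $ x $ y" using th(2) by simp
  qed
  have "F \<noteq> 0"
  proof
    assume F0: "F = 0"
    obtain x z where xz: "(x, z) \<in> R w" using R_nonempty[OF w_le] by blast
    obtain x' z' where xz': "(x', z') \<in> R u" using R_nonempty[OF u_le] by blast
    have "F $ x $ z = of_real (al * - \<rho>)" "F $ x' $ z' = of_real (al * (1 - \<rho>))"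
      unfolding F_def S_def A_0[symmetric] using xz xz' by (simp_all add: A_nth all_ones_def)
    then have "al * - \<rho> = 0" "al * (1 - \<rho>) = 0" unfolding F0 zero_index by (metis of_real_eq_0_iff)+
    then show False using ne by (simp add: al_def)
  qed
  \<comment> \<open>\<open>r\<close> counts the nonzero matrices among \<open>E1\<close> and
    \<open>E2\<close>; each of them has rank \<open>m\<close>.\<close>
  then obtain r :: nat where r: "r = 1 \<or> r = 2" "trace F = of_nat (r * m)"
  proof -
    have "trace F = trace E1 + trace E2" unfolding E12[symmetric] by (simp add: trace_simps)
    moreover have "\<not> (E1 = 0 \<and> E2 = 0)" using E12 \<open>F \<noteq> 0\<close> by auto
    ultimately show thesis using t1 t2 that[of 1] that[of 2] by (auto split: if_splits)
  qed
  have "trace F = of_real (al * (- \<tau> * (1 + 4 * real K) - \<rho> * (1 + 4 * real K)))"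
    unfolding F_def trace_simps S_def
    by (simp add: trace_A n_eq) (simp add: trace_def all_ones_def n_eq algebra_simps)
  then have "(of_real (al * (- \<tau> * (1 + 4 * real K) - (2 * real K - \<tau>))) :: complex) = of_real (real (r * m))"
    unfolding r(2) rn by simp
  then have "al * (- \<tau> * (1 + 4 * real K) - (2 * real K - \<tau>)) = real (r * m)"
    by (simp only: of_real_eq_iff)
  then have "- \<tau> * (1 + 4 * real K) - (2 * real K - \<tau>) = real (r * m) * (\<sigma> - \<tau>)"
    using ne by (simp add: al_def field_simps)
  then show thesis using r(1) by (intro that[of r]) (simp_all add: algebra_simps)
qed

lemma pseudocyclic_params:
  assumes "pseudocyclic d R"
  shows "a = 0" "b = 2" "c = 1" "f = 1" "K = 3" "g = 1"
proof -
  obtain m where m: "\<And>E. primitive_idempotent BM E \<Longrightarrow> E \<noteq> trivial_idempotent \<Longrightarrow> rank E = m"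
    using assms unfolding pseudocyclic_def by blast
  obtain s t where st: "b = f + s" "c = f + t" "s + t = 1 + a" "s * t = f * a" by (rule params)
  \<comment> \<open>\<sigma> and \<tau> will be the roots of x^2 + U x + W. They are real and
    distinct, because t <= 1 + a makes W negative.\<close>
  define U W :: int where "U = int c + 2 * int f - 3 * int a - int b" and "W = int c + 2 * int f - 2 * int K"
  have W: "W = int t - int f - 4 * int a - 2" unfolding W_def st val_eq_2 by simp
  define D where "D = real_of_int (U * U - 4 * W)"
  have "U * U \<ge> 0" by simp
  then have "U * U - 4 * W > 0" using W st(3) by linarith
  then have D: "D > 0" unfolding D_def by linarith
  define \<sigma> \<tau> where "\<sigma> = (- real_of_int U + sqrt D) / 2" and "\<tau> = (- real_of_int U - sqrt D) / 2"
  have sum: "\<sigma> + \<tau> = - real_of_int U" by (simp add: \<sigma>_def \<tau>_def field_simps)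
  have prod: "\<sigma> * \<tau> = real_of_int W"
  proof -
    have "\<sigma> * \<tau> = (real_of_int U * real_of_int U - sqrt D * sqrt D) / 4"
      by (simp add: \<sigma>_def \<tau>_def field_simps)
    also have "sqrt D * sqrt D = D" using D by simp
    finally show ?thesis by (simp add: D_def)
  qed
  have ne: "\<sigma> \<noteq> \<tau>" using D by (simp add: \<sigma>_def \<tau>_def)
  have U': "- real_of_int U = 3 * real a + real b - real c - 2 * real f"
    and W': "real_of_int W = real c + 2 * real f - 2 * real K" by (simp_all add: U_def W_def)
  obtain r1 :: nat where r1: "r1 = 1 \<or> r1 = 2" "- 4 * real K * \<tau> - 2 * real K = real (r1 * m) * (\<sigma> - \<tau>)"
    using eigenspace_trace[OF sum[unfolded U'] prod[unfolded W'] ne m] by metis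
  obtain r2 :: nat where r2: "r2 = 1 \<or> r2 = 2" "- 4 * real K * \<sigma> - 2 * real K = real (r2 * m) * (\<tau> - \<sigma>)"
    using eigenspace_trace[of \<tau> \<sigma> m] sum prod ne m U' W' by (metis add.commute mult.commute)
  \<comment> \<open>Cross-multiplying eliminates both \<open>m\<close> and \<sigma> - \<tau>. For r1
    = r2 the result is \<sigma> + \<tau> = -1.\<close>
  have "real r2 * (- 4 * real K * \<tau> - 2 * real K) = - real r1 * (- 4 * real K * \<sigma> - 2 * real K)"
    unfolding r1(2) r2(2) by (simp add: algebra_simps)
  then have "real K * (real r2 * (2 * \<tau> + 1)) = real K * - (real r1 * (2 * \<sigma> + 1))"
    by (simp add: algebra_simps)
  then have main: "real r2 * (2 * \<tau> + 1) = - (real r1 * (2 * \<sigma> + 1))"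
    using K_pos by (metis mult_left_cancel of_nat_0_eq_iff less_numeral_extra(3))
  \<comment> \<open>If one eigenspace splits and the other does not, an eigenvalue is a half-integer, although
    it is a root of a monic integer polynomial.\<close>
  have odd_root: False if "2 * x = 2 * real_of_int U - 3" "x * x + real_of_int U * x + real_of_int W = 0" for x
  proof -
    have "(2 * x) * (2 * x) + 2 * real_of_int U * (2 * x) + 4 * real_of_int W = 0"
      using that(2) by (simp add: algebra_simps)
    then have "real_of_int ((2 * U - 3) * (2 * U - 3) + 2 * U * (2 * U - 3) + 4 * W) = 0"
      unfolding that(1) by simp
    then have "(2 * U - 3) * (2 * U - 3) + 2 * U * (2 * U - 3) + 4 * W = 0" by (simp only: of_int_eq_0_iff)
    then have "even ((2 * U - 3) * (2 * U - 3) + 2 * U * (2 * U - 3) + 4 * W)" by simp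
    then show False by simp
  qed
  have root: "x * x + real_of_int U * x + real_of_int W = 0" if "x = \<sigma> \<or> x = \<tau>" for x
  proof -
    have "x * x + real_of_int U * x + real_of_int W = x * x - (\<sigma> + \<tau>) * x + \<sigma> * \<tau>" using sum prod by simp
    then show ?thesis using that by (auto simp: algebra_simps)
  qed
  have U1: "U = 1"
  proof -
    consider "r1 = r2" | "r1 = 1" "r2 = 2" | "r1 = 2" "r2 = 1" using r1(1) r2(1) by blast
    then show ?thesis
    proof cases
      case 1
      then have "2 * \<tau> + 1 = - (2 * \<sigma> + 1)" using main r1(1) by auto
      then have "real_of_int U = 1" using sum by simp
      then show ?thesis by simp
    next
      case 2
      then have "2 * \<tau> = 2 * real_of_int U - 3" using main sum by simp
      then show ?thesis using odd_root root by blast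
    next
      case 3
      then have "2 * \<sigma> = 2 * real_of_int U - 3" using main sum by simp
      then show ?thesis using odd_root root by blast
    qed
  qed
  \<comment> \<open>U = 1 in the variables of \<open>params\<close>; inserted into s t = f a it
    gives s^2 + a^2 = s.\<close>
  have fs: "f = a + s" using U1 st(1,2,3) unfolding U_def by linarith
  have t: "int t = 1 + int a - int s" using st(3) by linarith
  have "int s * int t = int f * int a" using st(4) by (metis of_nat_mult)
  then have "int s * (1 + int a - int s) = (int a + int s) * int a"
    unfolding t fs by simp
  then have eq: "int s * int s + int a * int a = int s" by (simp add: algebra_simps)
  have "int s \<le> int s * int s" by (cases "s = 0") auto
  moreover have "int a * int a \<ge> 0" by simp
  ultimately have "int a * int a = 0" "int s * int s = int s" using eq by linarith+
  then have "a = 0" "s \<le> 1" by auto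
  then have "s = 1" using fs f_pos by linarith
  then show "a = 0" "b = 2" "c = 1" "f = 1" "K = 3" "g = 1"
    using st fs \<open>a = 0\<close> val_eq_2 regular_params(3) by simp_all
qed

end

subsection \<open>The field with 13 elements\<close>

lemma diff_mod_13: "(n + 13 - m) mod 13 = n - m" if "m \<le> n" "n < 13" for m n :: nat
proof -
  have "n + 13 - m = (n - m) + 13" using that by linarith
  then have "(n + 13 - m) mod 13 = ((n - m) + 13) mod 13" by (simp only:)
  also have "\<dots> = (n - m) mod 13" by (rule mod_add_self2)
  also have "\<dots> = n - m" using that by (intro mod_less) linarith
  finally show ?thesis .
qed

lemma less_13_cases:
  "q = 0 \<or> q = 1 \<or> q = 2 \<or> q = 3 \<or> q = 4 \<or> q = 5 \<or> q = 6 \<or> q = 7 \<or> q = 8 \<or>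
    q = 9 \<or> q = 10 \<or> q = 11 \<or> q = 12" if "q < 13" for q :: nat
  using that by presburger

text \<open>Translation by 1 permutes the ring, so it does not change the sum of all
  elements.\<close>

lemma of_nat_CARD_eq_0: "of_nat CARD('f::{finite,ring_1}) = (0 :: 'f)"
proof -
  have "(\<Sum>x\<in>UNIV. x :: 'f) = (\<Sum>x\<in>UNIV. x + 1)"
    by (rule sum.reindex_bij_witness[of _ "\<lambda>x. x + 1" "\<lambda>x. x - 1"]) auto
  then show ?thesis by (simp add: sum.distrib)
qed

lemma field13_of_nat_eq_iff:
  assumes "CARD('f::{finite,field}) = 13"
  shows "(of_nat x :: 'f) = of_nat y \<longleftrightarrow> x mod 13 = y mod 13"
proof -
  have "CHAR('f) dvd 13" using of_nat_CARD_eq_0[where 'f = 'f] assms of_nat_eq_0_iff_char_dvd by metis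
  moreover have "prime (13 :: nat)" by (simp add: prime_nat_numeral_eq)
  moreover have "CHAR('f) \<noteq> 1" by (metis of_nat_1 of_nat_CHAR zero_neq_one)
  ultimately have char: "CHAR('f) = 13" by (metis prime_nat_iff)
  have le: "(of_nat x :: 'f) = of_nat y \<longleftrightarrow> x mod 13 = y mod 13" if "y \<le> x" for x y
  proof -
    have "(of_nat x :: 'f) = of_nat y \<longleftrightarrow> (of_nat (x - y) :: 'f) = 0" using that by (simp add: of_nat_diff)
    also have "\<dots> \<longleftrightarrow> 13 dvd x - y" by (simp only: of_nat_eq_0_iff_char_dvd char)
    finally show ?thesis using that mod_eq_dvd_iff_nat by blast
  qed
  show ?thesis using le[of x y] le[of y x] by (metis nat_le_linear)
qed

lemma field13_of_nat_bij:
  assumes "CARD('f::{finite,field}) = 13"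
  shows "bij_betw (of_nat :: nat \<Rightarrow> 'f) {..<13} UNIV"
proof -
  have inj: "inj_on (of_nat :: nat \<Rightarrow> 'f) {..<13}"
    by (auto simp: inj_on_def field13_of_nat_eq_iff[OF assms])
  then have "card ((of_nat :: nat \<Rightarrow> 'f) ` {..<13}) = CARD('f)" by (simp add: card_image assms)
  then have "(of_nat :: nat \<Rightarrow> 'f) ` {..<13} = UNIV" by (intro card_subset_eq) auto
  then show ?thesis using inj by (simp add: bij_betw_def)
qed

lemma power_int_mod_period:
  fixes x :: "'f::field"
  assumes "x ^ m = 1" "m > 0"
  shows "x powi n = x ^ nat (n mod int m)"
proof -
  have x: "x \<noteq> 0" using assms by (metis power_0_left neq0_conv zero_neq_one)
  have "x powi n = x powi (int m * (n div int m) + n mod int m)" by simp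
  also have "\<dots> = (x powi int m) powi (n div int m) * x powi (n mod int m)"
    using x by (simp only: power_int_add power_int_mult simp_thms)
  also have "x powi int m = 1" using assms(1) by simp
  finally show ?thesis using assms(2) by (simp add: power_int_def)
qed

lemma primitive_element_order:
  fixes \<alpha> :: "'f::{finite,field}"
  assumes "primitive_element \<alpha>" "\<alpha> ^ m = 1" "m > 0"
  shows "CARD('f) - 1 \<le> m"
proof -
  have "range (\<lambda>n::int. \<alpha> powi n) \<subseteq> (\<lambda>i. \<alpha> ^ i) ` {..<m}"
  proof (rule image_subsetI)
    fix n :: int
    have "nat (n mod int m) < m" using assms(3) by (simp add: nat_less_iff)
    then show "\<alpha> powi n \<in> (\<lambda>i. \<alpha> ^ i) ` {..<m}"
      using power_int_mod_period[OF assms(2,3), of n] by blast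
  qed
  then have "card (range (\<lambda>n::int. \<alpha> powi n)) \<le> card ((\<lambda>i. \<alpha> ^ i) ` {..<m})"
    by (intro card_mono) auto
  also have "\<dots> \<le> m" using card_image_le[of "{..<m}" "\<lambda>i. \<alpha> ^ i"] by simp
  finally show ?thesis using assms(1) by (simp add: primitive_element_def card_Diff_singleton)
qed

text \<open>The sets are the cosets of {1, 3, 9}, the group of nonzero fourth powers. Another
  primitive element only changes which exponent \<open>j\<close> labels which coset.\<close>

lemma field13_cosets:
  fixes \<alpha> :: "'f::{finite,field}"
  assumes card: "CARD('f) = 13" and prim: "primitive_element \<alpha>"
    and D: "D \<in> {{4, 10, 12}, {1, 3, 9}, {7, 8, 11}, {2, 5, 6}}"
  shows "\<exists>j\<in>{1..4}. range (\<lambda>n::int. \<alpha> ^ j * (\<alpha> ^ 4) powi n) = of_nat ` D"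
proof -
  note iff = field13_of_nat_eq_iff[OF card]
  obtain r :: nat where r: "r < 13" "\<alpha> = of_nat r"
    using field13_of_nat_bij[OF card] unfolding bij_betw_def by (metis UNIV_I imageE lessThan_iff)
  have pow: "\<alpha> ^ j = of_nat (r ^ j mod 13)" for j
    unfolding r(2) of_nat_power[symmetric] iff by simp
  have no: "r ^ m mod 13 \<noteq> 1" if "0 < m" "m < 12" for m
  proof
    assume "r ^ m mod 13 = 1"
    then have "\<alpha> ^ m = 1" unfolding pow by simp
    then show False using primitive_element_order[OF prim] that card by fastforce
  qed
  have "\<alpha> \<noteq> 0"
  proof
    assume "\<alpha> = 0"
    then have "\<alpha> powi 1 = 0" by simp
    moreover have "\<alpha> powi 1 \<in> UNIV - {0}" using prim unfolding primitive_element_def by blast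
    ultimately show False by simp
  qed
  then have "r \<noteq> 0" using r(2) by (metis of_nat_0)
  \<comment> \<open>Every proper divisor of 12 divides 4 or 6, so these two exponents sift out the
    primitive roots modulo 13.\<close>
  then have r4: "r = 2 \<or> r = 6 \<or> r = 7 \<or> r = 11"
    using less_13_cases[OF r(1)] no[of 4] no[of 6] by - (elim disjE; simp)
  then have p12: "(\<alpha> ^ 4) ^ 3 = 1"
  proof -
    have "r ^ 12 mod 13 = 1" using r4 by (elim disjE) simp_all
    then show ?thesis unfolding power_mult[symmetric] using pow[of 12] by simp
  qed
  have range: "range (\<lambda>n::int. \<alpha> ^ j * (\<alpha> ^ 4) powi n) =
      of_nat ` {r ^ j mod 13, r ^ (j + 4) mod 13, r ^ (j + 8) mod 13}" (is "?L = ?R") for j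
  proof -
    have eq: "\<alpha> ^ j * (\<alpha> ^ 4) powi n = \<alpha> ^ (j + 4 * nat (n mod 3))" for n :: int
      using power_int_mod_period[OF p12, of n] by (simp add: power_add power_mult)
    have R: "?R = {\<alpha> ^ j, \<alpha> ^ (j + 4), \<alpha> ^ (j + 8)}" by (simp add: pow)
    show ?thesis
    proof
      show "?L \<subseteq> ?R"
      proof (rule image_subsetI)
        fix n :: int
        have "n mod 3 = 0 \<or> n mod 3 = 1 \<or> n mod 3 = 2" by presburger
        then show "\<alpha> ^ j * (\<alpha> ^ 4) powi n \<in> ?R" unfolding R eq by (elim disjE) simp_all
      qed
      have "\<alpha> ^ (j + 4 * nat (n mod 3)) \<in> ?L" for n :: int unfolding eq[symmetric] by blast
      from this[of 0] this[of 1] this[of 2] show "?R \<subseteq> ?L" unfolding R by simp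
    qed
  qed
  \<comment> \<open>Squares of primitive roots always lie in {4, 10, 12}. The primitive roots 2, 6
    lie in {2, 5, 6} and 7, 11 in {7, 8, 11}, so only the labels 1 and 3 depend on
    \<open>r\<close>.\<close>
  define j :: nat where "j = (if D = {4, 10, 12} then 2 else if D = {1, 3, 9} then 4
    else if (D = {7, 8, 11}) = (r \<in> {2, 6}) then 3 else 1)"
  have "{r ^ j mod 13, r ^ (j + 4) mod 13, r ^ (j + 8) mod 13} = D"
    using r4 D unfolding j_def by (elim disjE insertE emptyE) (simp_all add: set_eq_iff, auto)
  then have "range (\<lambda>n::int. \<alpha> ^ j * (\<alpha> ^ 4) powi n) = of_nat ` D" by (simp only: range)
  moreover have "j \<in> {1..4}" by (simp add: j_def)
  ultimately show ?thesis by blast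
qed

subsection \<open>Uniqueness in the pseudocyclic case\<close>

locale pseudocyclic_narrow_scheme = narrow_scheme +
  assumes pseudocyclic: "pseudocyclic d R"
begin

lemmas params13 = pseudocyclic_params[OF pseudocyclic]

section \<open>Composition rules for the classes of pairs\<close>

definition cl :: "'a \<Rightarrow> 'a \<Rightarrow> nat" where
  "cl x y = (THE l. l \<le> d \<and> (x, y) \<in> R l)"

lemma cl_props: "cl x y \<le> d \<and> (x, y) \<in> R (cl x y)"
proof -
  obtain l where "l \<le> d \<and> (x, y) \<in> R l" using R_total by blast
  then show ?thesis unfolding cl_def using R_unique
    by (intro theI[of "\<lambda>l. l \<le> d \<and> (x, y) \<in> R l" l]) blast+
qed

lemma cl_eq_iff: "l \<le> d \<Longrightarrow> cl x y = l \<longleftrightarrow> (x, y) \<in> R l"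
  using cl_props R_unique by metis

lemma cl_tr: "cl y x = tr (cl x y)"
  using cl_props[of x y] by (simp add: cl_eq_iff tr_iff)

lemma cl_0: "cl x y = 0 \<longleftrightarrow> x = y"
  by (simp add: cl_eq_iff R_0)

lemma cl_swap: "cl x y = u \<longleftrightarrow> cl y x = u'" "cl x y = w \<longleftrightarrow> cl y x = w'"
  "cl x y = u' \<longleftrightarrow> cl y x = u" "cl x y = w' \<longleftrightarrow> cl y x = w"
  using cl_tr[of x y] cl_tr[of y x] by auto

lemma cl_comp: "p (cl x z) (cl z y) (cl x y) \<noteq> 0"
  using p_neq_0I[of x z "cl x z" y "cl z y" "cl x y"] cl_props by blast

text \<open>h = 0 removes \<open>u\<close> from B^2, and the row sum 9 of B B^T is used up by 0,
  \<open>u\<close> and \<open>u'\<close>.\<close>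

lemma p_ww: "p w w u = 0" "p w w w = 0" "p w w 0 = 0" "p w w' w = 0" "p w w' w' = 0"
proof -
  show "p w w u = 0" using p_upper_exchange[of w w u] K_pos regular_params(2) by simp
  show "p w w 0 = 0" by (simp add: p_0_upper)
  have 1: "p w w' 0 = 3" using params13 by (simp add: p_0_upper)
  have 2: "p w w' u = 1" using p_upper_exchange[of w w' u] K_pos params13 by simp
  have 3: "p w w' u' = 1" using p_tr[of w w' u] p_commute[of w w' u'] 2 by simp
  have "(\<Sum>l\<le>d. k l * p w w' l) = 9" using p_row_sum[of w w'] params13 by simp
  then have s: "p w w' w + p w w' w' = 0"
    unfolding sum_idx_split regular_params(1)[symmetric] using 1 2 3 params13 by simp
  then show "p w w' w = 0" "p w w' w' = 0" by simp_all
  then show "p w w w = 0" using p_upper_exchange[of w w w] K_pos by simp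
qed

lemma p_support:
  "\<lbrakk>l \<le> d; p u u l \<noteq> 0\<rbrakk> \<Longrightarrow> l = u' \<or> l = w"
  "\<lbrakk>l \<le> d; p u' u' l \<noteq> 0\<rbrakk> \<Longrightarrow> l = u \<or> l = w'"
  "\<lbrakk>l \<le> d; p u u' l \<noteq> 0\<rbrakk> \<Longrightarrow> l = 0 \<or> l = w \<or> l = w'"
  "\<lbrakk>l \<le> d; p u' u l \<noteq> 0\<rbrakk> \<Longrightarrow> l = 0 \<or> l = w \<or> l = w'"
  "\<lbrakk>l \<le> d; p u w l \<noteq> 0\<rbrakk> \<Longrightarrow> l = u \<or> l = w \<or> l = w'"
  "\<lbrakk>l \<le> d; p w u l \<noteq> 0\<rbrakk> \<Longrightarrow> l = u \<or> l = w \<or> l = w'"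
  "\<lbrakk>l \<le> d; p w w l \<noteq> 0\<rbrakk> \<Longrightarrow> l = u' \<or> l = w'"
  "\<lbrakk>l \<le> d; p w w' l \<noteq> 0\<rbrakk> \<Longrightarrow> l = 0 \<or> l = u \<or> l = u'"
  by (frule idx_cases, elim disjE; simp add: params13 p_ww p_commute[of u' u] p_commute[of w u])+

lemma compose: "cl x z = i \<Longrightarrow> cl z y = j \<Longrightarrow> p i j (cl x y) \<noteq> 0"
  using cl_comp by blast

lemma cl_le: "cl x y \<le> d"
  using cl_props by blast

lemmas comp_table = p_support[OF cl_le compose]

lemma cl_unique:
  assumes "p i j (cl x y) = 1" "i \<le> d" "j \<le> d" "cl x z = i" "cl z y = j" "cl x z' = i" "cl z' y = j"
  shows "z = z'"
  using p_eq_1_unique[of i j "cl x y" x y z z'] assms cl_props by metis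

lemma cl_ex:
  assumes "p i j (cl x y) \<noteq> 0" "i \<le> d" "j \<le> d"
  obtains z where "cl x z = i" "cl z y = j"
  using p_neq_0E[of i j "cl x y" x y] assms cl_props by (metis cl_eq_iff)

text \<open>This and the next three lemmas restate c = f = 1 for walks, in the four positions where
  these intersection numbers occur; they supply the rigidity of the scheme.\<close>

lemma unique_mid: "cl x y = w \<Longrightarrow> cl x z = u \<Longrightarrow> cl z y = u \<Longrightarrow> cl x z' = u \<Longrightarrow> cl z' y = u \<Longrightarrow> z = z'"
  by (rule cl_unique[of u u x y]) (simp_all add: params13)

lemma unique_common:
  assumes "cl x y = w" "cl x z = u" "cl y z = u" "cl x z' = u" "cl y z' = u"
  shows "z = z'"
proof -
  have "cl z y = u'" "cl z' y = u'" using assms(3,5) cl_swap by blast+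
  then show ?thesis by (intro cl_unique[of u u' x y]) (simp_all add: assms params13)
qed

lemma unique_turn:
  assumes "cl x y = u" "cl x z = u" "cl y z = w" "cl x z' = u" "cl y z' = w"
  shows "z = z'"
proof -
  have "cl z y = w'" "cl z' y = w'" using assms(3,5) cl_swap by blast+
  then show ?thesis by (intro cl_unique[of u w' x y]) (simp_all add: assms params13)
qed

lemma unique_next:
  assumes "cl x y = u" "cl y z = u" "cl x z = w" "cl y z' = u" "cl x z' = w"
  shows "z = z'"
proof -
  have "cl z x = w'" "cl z' x = w'" "cl y x = u'" using assms(1,3,5) cl_swap by blast+
  then show ?thesis by (intro cl_unique[of u w' y x]) (simp_all add: assms params13)
qed

lemma ex_next:
  assumes "cl x y = u"
  shows "\<exists>z. cl y z = u \<and> cl x z = w"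
proof -
  have "cl y x = u'" using assms cl_swap by blast
  then have "p u w' (cl y x) \<noteq> 0" by (simp add: params13)
  then obtain z where "cl y z = u" "cl z x = w'" by (rule cl_ex) auto
  then show ?thesis using cl_swap by blast
qed

lemma ex_sequence:
  obtains X :: "nat \<Rightarrow> 'a" where "\<And>i. cl (X i) (X (i + 1)) = u" "\<And>i. cl (X i) (X (i + 2)) = w"
proof -
  obtain x0 x1 where x: "(x0, x1) \<in> R u" using R_nonempty[OF u_le] by blast
  define nxt where "nxt x y = (SOME z. cl y z = u \<and> cl x z = w)" for x y
  have nxt: "cl y (nxt x y) = u \<and> cl x (nxt x y) = w" if "cl x y = u" for x y
    unfolding nxt_def by (rule someI_ex[OF ex_next[OF that]])
  define s where "s n = ((\<lambda>(x, y). (y, nxt x y)) ^^ n) (x0, x1)" for n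
  have s_Suc: "s (Suc n) = (snd (s n), nxt (fst (s n)) (snd (s n)))" for n
    by (simp add: s_def split_beta)
  have step: "cl (fst (s n)) (snd (s n)) = u" for n
  proof (induction n)
    case 0
    then show ?case using x by (simp add: s_def cl_eq_iff)
  next
    case (Suc n)
    then show ?case using nxt by (simp add: s_Suc)
  qed
  show thesis
  proof (rule that[of "\<lambda>n. fst (s n)"])
    show "cl (fst (s i)) (fst (s (i + 1))) = u" for i using step by (simp add: s_Suc)
    show "cl (fst (s i)) (fst (s (i + 2))) = w" for i using nxt[OF step[of i]] by (simp add: s_Suc)
  qed
qed

text \<open>In \<open>Cyc(13,4)\<close> these are the progressions \<open>x + i\<gamma>\<close> with \<open>(0, \<gamma>) \<in> R u\<close>.\<close>

definition geodesic :: "(nat \<Rightarrow> 'a) \<Rightarrow> bool" where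
  "geodesic X \<longleftrightarrow> (\<forall>i. cl (X i) (X (i + 1)) = u \<and> cl (X i) (X (i + 2)) = w)"

context
  fixes X :: "nat \<Rightarrow> 'a"
  assumes X: "geodesic X"
begin

lemma step1: "cl (X i) (X (i + 1)) = u"
  and step2: "cl (X i) (X (i + 2)) = w"
  using X unfolding geodesic_def by blast+

lemma step1': "n = m + 1 \<Longrightarrow> cl (X m) (X n) = u"
  and step2': "n = m + 2 \<Longrightarrow> cl (X m) (X n) = w"
  using step1[of m] step2[of m] by blast+

text \<open>Take t with (x, t) in \<open>R u\<close> and (y, t) in \<open>R w\<close>, and a
  midpoint z' of y and t. The class \<open>u'\<close> for (x, z') would compose with (x, t) to
  exclude \<open>u\<close> for (z', t); so (x, z') lies in \<open>R w\<close>, and uniqueness of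
  continuation identifies z' and t with the next two points of the walk.\<close>

lemma step3: "cl (X i) (X (i + 3)) = u"
proof -
  define x y z where "x = X i" and "y = X (i + 1)" and "z = X (i + 2)"
  have xy: "cl x y = u" unfolding x_def y_def by (rule step1)
  have yz: "cl y z = u" unfolding y_def z_def by (rule step1') simp
  have xz: "cl x z = w" unfolding x_def z_def by (rule step2)
  have "p u w' (cl x y) \<noteq> 0" by (simp add: xy params13)
  then obtain t where "cl x t = u" "cl t y = w'" by (rule cl_ex) auto
  then have t: "cl x t = u" "cl y t = w" using cl_swap by blast+
  have "p u u (cl y t) \<noteq> 0" by (simp add: t params13)
  then obtain z' where z': "cl y z' = u" "cl z' t = u" by (rule cl_ex) auto
  have "cl x z' \<noteq> u'"
  proof
    assume "cl x z' = u'"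
    then have "cl z' x = u" using cl_swap by blast
    then have "cl z' t = u' \<or> cl z' t = w" using t(1) by (rule comp_table(1))
    then show False using z'(2) by simp
  qed
  then have "cl x z' = w" using comp_table(1)[OF xy z'(1)] by blast
  then have "z' = z" using unique_next[OF xy z'(1) _ yz xz] by blast
  moreover have "cl y (X (i + 3)) = w" "cl z (X (i + 3)) = u"
    unfolding y_def z_def by (rule step2', simp) (rule step1', simp)
  ultimately have "t = X (i + 3)" using unique_next[OF yz] z'(2) t(2) by blast
  then show ?thesis using t(1) x_def by simp
qed

lemma step3': "n = m + 3 \<Longrightarrow> cl (X m) (X n) = u"
  using step3[of m] by blast

lemma shifts:
  "cl (X (i + 3)) (X (i + 4)) = u" "cl (X (i + 1)) (X (i + 4)) = u" "cl (X (i + 1)) (X (i + 3)) = w"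
  "cl (X (i + 3)) (X (i + 5)) = w" "cl (X (i + 4)) (X (i + 5)) = u" "cl (X (i + 4)) (X (i + 7)) = u"
  "cl (X (i + 5)) (X (i + 7)) = w" "cl (X (i + 6)) (X (i + 7)) = u"
  by (rule step1' step2' step3'; simp)+

text \<open>The class \<open>w\<close> would give this pair the two midpoints
  \<open>X (i + 1)\<close> and \<open>X (i + 3)\<close>.\<close>

lemma step4: "cl (X i) (X (i + 4)) = u'"
proof -
  have "cl (X i) (X (i + 4)) \<noteq> w"
  proof
    assume "cl (X i) (X (i + 4)) = w"
    then have "X (i + 1) = X (i + 3)"
      by (rule unique_mid) (fact step1 step3 shifts)+
    then show False using shifts(3)[of i] cl_0[of "X (i + 1)" "X (i + 3)"] by simp
  qed
  then show ?thesis using comp_table(1)[OF step1 shifts(2)] by blast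
qed

lemma step4': "n = m + 4 \<Longrightarrow> cl (X m) (X n) = u'"
  using step4[of m] by blast

lemma step5_cases: "cl (X i) (X (i + 5)) = w \<or> cl (X i) (X (i + 5)) = w'"
proof -
  have 1: "cl (X (i + 1)) (X (i + 5)) = u'" by (rule step4') simp
  show ?thesis
    using comp_table(3)[OF step1[of i] 1] comp_table(5)[OF step3[of i] shifts(4)[of i]]
    by - (elim disjE; simp)
qed

lemma step5_cases': "n = m + 5 \<Longrightarrow> cl (X m) (X n) = w \<or> cl (X m) (X n) = w'"
  using step5_cases[of m] by blast

text \<open>Under the assumption \<open>X i\<close> and \<open>X (i + 7)\<close> stand in the same
  relations to \<open>X (i + 4)\<close> and \<open>X (i + 5)\<close>, and \<open>unique_turn\<close>
  applies.\<close>

lemma period: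
  assumes "cl (X i) (X (i + 5)) = w'"
  shows "X (i + 7) = X i"
  by (rule unique_turn[OF shifts(5)]) (use assms step4[of i] shifts cl_swap in blast)+

lemma period_Suc:
  assumes "cl (X i) (X (i + 5)) = w'"
  shows "cl (X (i + 1)) (X (i + 6)) = w'"
proof (rule ccontr)
  assume "cl (X (i + 1)) (X (i + 6)) \<noteq> w'"
  then have "cl (X (i + 1)) (X (i + 6)) = w" using step5_cases'[of "i + 6" "i + 1"] by simp
  then have 1: "cl (X (i + 6)) (X (i + 1)) = w'" using cl_swap by blast
  have "cl (X (i + 6)) (X i) = u" using shifts(8)[of i] period[OF assms] by simp
  then have "cl (X (i + 6)) (X (i + 1)) = u' \<or> cl (X (i + 6)) (X (i + 1)) = w"
    using step1[of i] by (rule comp_table(1))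
  then show False using 1 by simp
qed

text \<open>
  A geodesic of period 7 would have seven distinct points, and the third out-neighbours of
  these would be seven further points: one more than there are.
\<close>

lemma not_period_0: "cl (X 0) (X 5) \<noteq> w'"
proof
  assume s0: "cl (X 0) (X 5) = w'"
  have s5: "cl (X i) (X (i + 5)) = w'" for i
  proof (induction i)
    case 0
    then show ?case using s0 by simp
  next
    case (Suc i)
    have "Suc i = i + 1" "Suc i + 5 = i + 6" by simp_all
    then show ?case using period_Suc[OF Suc] by metis
  qed
  have per: "X (i + 7) = X i" for i using period[OF s5] .
  have s6: "cl (X i) (X (i + 6)) = u'" for i
    using shifts(8)[of i] per[of i] cl_swap by metis
  have e_cases: "e = 1 \<or> e = 2 \<or> e = 3 \<or> e = 4 \<or> e = 5 \<or> e = 6" if "e > 0" "e < 7" for e :: nat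
    using that by linarith
  note steps = step1 step2 step3 step4 s5 s6
  have steps_0: "cl (X i) (X (i + e)) \<noteq> 0" if "e > 0" "e < 7" for i e
    using e_cases[OF that] steps[of i] by - (elim disjE; simp)
  have steps_u: "e = 1 \<or> e = 3" if "e > 0" "e < 7" "cl (X i) (X (i + e)) = u" for i e
    using e_cases[OF that(1,2)] steps[of i] that(3) by - (elim disjE; simp)
  have steps_w: "e = 2 \<or> e = 5" if "e > 0" "e < 7"
    "cl (X i) (X (i + e)) = w \<or> cl (X i) (X (i + e)) = w'" for i e
    using e_cases[OF that(1,2)] steps[of i] that(3) by - (elim disjE; simp)
  have "\<exists>z. cl (X i) z = u \<and> z \<noteq> X (i + 1) \<and> z \<noteq> X (i + 3)" for i
  proof (rule ccontr)
    assume "\<not> ?thesis"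
    then have "{z. (X i, z) \<in> R u} \<subseteq> {X (i + 1), X (i + 3)}" by (auto simp: cl_eq_iff)
    then have "card {z. (X i, z) \<in> R u} \<le> card {X (i + 1), X (i + 3)}" by (intro card_mono) auto
    also have "\<dots> \<le> 2" by (simp add: card_insert_if)
    finally show False using valency_eq_card[of u "X i"] params13 by simp
  qed
  then obtain Z where Z: "cl (X i) (Z i) = u" "Z i \<noteq> X (i + 1)" "Z i \<noteq> X (i + 3)" for i by metis
  have XX: "X i \<noteq> X j" if "i < j" "j < 7" for i j
  proof
    assume "X i = X j"
    then have 0: "cl (X i) (X j) = 0" using cl_0 by blast
    have "j - i < 7" "j - i > 0" "i + (j - i) = j" using that by linarith+
    then show False using steps_0[of "j - i" i] 0 by simp
  qed
  have ZX': "Z i \<noteq> X (i + e)" if "e < 7" for i e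
  proof
    assume eq: "Z i = X (i + e)"
    then have "cl (X i) (X (i + e)) = u" using Z(1)[of i] by simp
    moreover have "e \<noteq> 0" using calculation cl_0[of "X i" "X i"] by (metis add_0_right distinct_idx(1))
    ultimately have "e = 1 \<or> e = 3" using steps_u[of e i] that by simp
    then show False using eq Z by auto
  qed
  have ZX: "Z i \<noteq> X j" if "i < 7" "j < 7" for i j
  proof (cases "i \<le> j")
    case True
    then show ?thesis using ZX'[of "j - i" i] that by simp
  next
    case False
    then have "Z i \<noteq> X (i + (j + 7 - i))" using that by (intro ZX') linarith
    then show ?thesis using per[of j] that by simp
  qed
  \<comment> \<open>A common out-neighbour puts (X i, X j) into \<open>R w\<close> or its transpose,
    so j - i is 2 or 5. As f = 1, it is then the point \<open>X (i + 3)\<close> or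
    \<open>X (i + 1)\<close> of the walk, which the choice of \<open>Z\<close> avoids.\<close>
  have ZZ: "Z i \<noteq> Z j" if "i < j" "j < 7" for i j
  proof
    assume eq: "Z i = Z j"
    have zj: "cl (X j) (Z i) = u" using Z(1)[of j] eq by simp
    then have "cl (Z i) (X j) = u'" using cl_swap by blast
    then have "cl (X i) (X j) = 0 \<or> cl (X i) (X j) = w \<or> cl (X i) (X j) = w'"
      by (rule comp_table(3)[OF Z(1)])
    moreover have e: "j - i < 7" "j - i > 0" "i + (j - i) = j" using that by linarith+
    ultimately have "j - i = 2 \<or> j - i = 5"
      using steps_w[OF e(2,1), of i] steps_0[OF e(2,1), of i] by simp
    then show False
    proof
      assume "j - i = 2"
      then have j: "j = i + 2" using that by simp
      have "cl (X (i + 2)) (X (i + 3)) = u" by (rule step1') simp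
      then have "Z i = X (i + 3)" using unique_common[OF step2[of i] Z(1)[of i]] zj step3[of i] unfolding j by blast
      then show False using Z(3) by blast
    next
      assume "j - i = 5"
      then have j: "j = i + 5" using that by simp
      have "cl (X (i + 5)) (X i) = w" using s5[of i] cl_swap by blast
      moreover have "cl (X (i + 5)) (X (i + 8)) = u" by (rule step3') simp
      moreover have "X (i + 8) = X (i + 1)" using per[of "i + 1"] by (simp add: add.commute)
      ultimately have "Z i = X (i + 1)"
        using unique_common[OF _ zj[unfolded j] Z(1)[of i] _ step1[of i]] by simp
      then show False using Z(2) by blast
    qed
  qed
  define H where "H n = (if n < 7 then X n else Z (n - 7))" for n
  have "H m \<noteq> H n" if "m < n" "n < 14" for m n
  proof -
    consider "n < 7" | "m < 7" "7 \<le> n" | "7 \<le> m" by linarith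
    then show ?thesis
    proof cases
      case 1
      then show ?thesis using that(1) XX[of m n] by (simp add: H_def)
    next
      case 2
      have "n - 7 < 7" using that(2) by linarith
      then have "Z (n - 7) \<noteq> X m" using ZX 2(1) by blast
      then show ?thesis using 2 by (simp add: H_def)
    next
      case 3
      then show ?thesis using that ZZ[of "m - 7" "n - 7"] by (simp add: H_def)
    qed
  qed
  then have "inj_on H {..<14}" by (intro linorder_inj_onI) auto
  then have "card (H ` {..<14}) = 14" by (simp add: card_image)
  moreover have "card (H ` {..<14}) \<le> CARD('a)" by (intro card_mono) auto
  ultimately show False using n_eq params13 by simp
qed

end

text \<open>Transfers \<open>not_period_0\<close> from the start of a walk to all of its
  points.\<close>

lemma geodesic_shift: "geodesic X \<Longrightarrow> geodesic (\<lambda>n. X (i + n))"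
  unfolding geodesic_def by (metis add.assoc)

text \<open>From distance 6 on, two ways of splitting the walk give two lists of possible classes
  with a single common member. Distance 10 is the exception: one splitting leaves \<open>u'\<close>
  and \<open>w\<close>, and uniqueness of midpoints excludes \<open>w\<close>.\<close>

lemma geodesic_table:
  assumes X: "geodesic X"
  shows "cl (X i) (X (i + 1)) = u" "cl (X i) (X (i + 2)) = w" "cl (X i) (X (i + 3)) = u"
    "cl (X i) (X (i + 4)) = u'" "cl (X i) (X (i + 5)) = w" "cl (X i) (X (i + 6)) = w"
    "cl (X i) (X (i + 7)) = w'" "cl (X i) (X (i + 8)) = w'" "cl (X i) (X (i + 9)) = u"
    "cl (X i) (X (i + 10)) = u'" "cl (X i) (X (i + 11)) = w'" "cl (X i) (X (i + 12)) = u'"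
proof -
  note k1 = step1'[OF X]
  note k2 = step2'[OF X]
  note k3 = step3'[OF X]
  note k4 = step4'[OF X]
  have k5: "cl (X m) (X n) = w" if "n = m + 5" for m n
    using not_period_0[OF geodesic_shift[OF X, of m]] step5_cases[OF X, of m] that by simp
  have k6: "cl (X m) (X n) = w" if n: "n = m + 6" for m n
  proof -
    have "cl (X m) (X (m + 3)) = u" "cl (X (m + 3)) (X n) = u"
      by (rule k3 k3; simp add: n)+
    note c1 = comp_table(1)[OF this]
    have "cl (X m) (X (m + 5)) = w" "cl (X (m + 5)) (X n) = u"
      by (rule k5 k1; simp add: n)+
    note c2 = comp_table(6)[OF this]
    from c1 c2 show ?thesis by - (elim disjE; simp)
  qed
  have k7: "cl (X m) (X n) = w'" if n: "n = m + 7" for m n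
  proof -
    have "cl (X m) (X (m + 4)) = u'" "cl (X (m + 4)) (X n) = u"
      by (rule k4 k3; simp add: n)+
    note c1 = comp_table(4)[OF this]
    have "cl (X m) (X (m + 2)) = w" "cl (X (m + 2)) (X n) = w"
      by (rule k2 k5; simp add: n)+
    note c2 = comp_table(7)[OF this]
    from c1 c2 show ?thesis by - (elim disjE; simp)
  qed
  have k8: "cl (X m) (X n) = w'" if n: "n = m + 8" for m n
  proof -
    have "cl (X m) (X (m + 4)) = u'" "cl (X (m + 4)) (X n) = u'"
      by (rule k4 k4; simp add: n)+
    note c1 = comp_table(2)[OF this]
    have "cl (X m) (X (m + 2)) = w" "cl (X (m + 2)) (X n) = w"
      by (rule k2 k6; simp add: n)+
    note c2 = comp_table(7)[OF this]
    from c1 c2 show ?thesis by - (elim disjE; simp)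
  qed
  have k9: "cl (X m) (X n) = u" if n: "n = m + 9" for m n
  proof -
    have "cl (X m) (X (m + 3)) = u" "cl (X (m + 3)) (X n) = w"
      by (rule k3 k6; simp add: n)+
    note c1 = comp_table(5)[OF this]
    have "cl (X m) (X (m + 2)) = w" "cl (X (m + 2)) (X n) = w'"
      by (rule k2 k7; simp add: n)+
    note c2 = comp_table(8)[OF this]
    from c1 c2 show ?thesis by - (elim disjE; simp)
  qed
  have k10: "cl (X m) (X n) = u'" if n: "n = m + 10" for m n
  proof -
    have "cl (X m) (X (m + 9)) = u" "cl (X (m + 9)) (X n) = u"
      by (rule k9 k1; simp add: n)+
    note c1 = comp_table(1)[OF this]
    have "cl (X m) (X n) \<noteq> w"
    proof
      assume "cl (X m) (X n) = w"
      then have "X (m + 1) = X (m + 9)"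
        by (rule unique_mid) (rule k1 k9; simp add: n)+
      moreover have "cl (X (m + 1)) (X (m + 9)) = w'" by (rule k8) simp
      ultimately show False using cl_0[of "X (m + 1)" "X (m + 9)"] by simp
    qed
    then show ?thesis using c1 by simp
  qed
  have k11: "cl (X m) (X n) = w'" if n: "n = m + 11" for m n
  proof -
    have "cl (X m) (X (m + 1)) = u" "cl (X (m + 1)) (X n) = u'"
      by (rule k1 k10; simp add: n)+
    note c1 = comp_table(3)[OF this]
    have "cl (X m) (X (m + 5)) = w" "cl (X (m + 5)) (X n) = w"
      by (rule k5 k6; simp add: n)+
    note c2 = comp_table(7)[OF this]
    from c1 c2 show ?thesis by - (elim disjE; simp)
  qed
  have k12: "cl (X m) (X n) = u'" if n: "n = m + 12" for m n
  proof -
    have "cl (X m) (X (m + 9)) = u" "cl (X (m + 9)) (X n) = u"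
      by (rule k9 k3; simp add: n)+
    note c1 = comp_table(1)[OF this]
    have "cl (X m) (X (m + 6)) = w" "cl (X (m + 6)) (X n) = w"
      by (rule k6 k6; simp add: n)+
    note c2 = comp_table(7)[OF this]
    from c1 c2 show ?thesis by - (elim disjE; simp)
  qed
  show "cl (X i) (X (i + 1)) = u" "cl (X i) (X (i + 2)) = w" "cl (X i) (X (i + 3)) = u"
    "cl (X i) (X (i + 4)) = u'" "cl (X i) (X (i + 5)) = w" "cl (X i) (X (i + 6)) = w"
    "cl (X i) (X (i + 7)) = w'" "cl (X i) (X (i + 8)) = w'" "cl (X i) (X (i + 9)) = u"
    "cl (X i) (X (i + 10)) = u'" "cl (X i) (X (i + 11)) = w'" "cl (X i) (X (i + 12)) = u'"
    by (rule k1 k2 k3 k4 k5 k6 k7 k8 k9 k10 k11 k12; simp)+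
qed

text \<open>The cosets of {1, 3, 9} modulo 13: \<open>u\<close> is the group itself,
  \<open>u'\<close> its negative, \<open>w\<close> its double, and the final branch serves {7, 8,
  11}.\<close>

definition diff_class :: "nat \<Rightarrow> nat" where
  "diff_class e = (if e = 0 then 0 else if e \<in> {1, 3, 9} then u else if e \<in> {4, 10, 12} then u'
    else if e \<in> {2, 5, 6} then w else w')"

text \<open>The class depends on n - m modulo 13; adding 13 first avoids truncated
  subtraction.\<close>

lemma geodesic_cl:
  assumes X: "geodesic X" and mn: "m < 13" "n < 13"
  shows "cl (X m) (X n) = diff_class ((n + 13 - m) mod 13)"
proof -
  have up: "cl (X i) (X (i + e)) = diff_class e" if "0 < e" "e < 13" for i e
    using less_13_cases[OF that(2)] that(1)
    by - (elim disjE; hypsubst; (subst geodesic_table[OF X])?; simp add: diff_class_def)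
  have diff_class_tr: "tr (diff_class e) = diff_class (13 - e)" if "0 < e" "e < 13" for e
    using less_13_cases[OF that(2)] that(1) by - (elim disjE; simp add: diff_class_def)
  consider "m < n" | "m = n" | "n < m" by linarith
  then show ?thesis
  proof cases
    case 1
    have "cl (X m) (X (m + (n - m))) = diff_class (n - m)" using 1 mn by (intro up) auto
    moreover have "(n + 13 - m) mod 13 = n - m" using 1 mn by (intro diff_mod_13) auto
    ultimately show ?thesis using 1 by simp
  next
    case 2
    then show ?thesis using cl_0[of "X m" "X n"] by (simp add: diff_class_def)
  next
    case 3
    have "cl (X n) (X (n + (m - n))) = diff_class (m - n)" using 3 mn by (intro up) auto
    then have "cl (X m) (X n) = tr (diff_class (m - n))" using 3 cl_tr[of "X m" "X n"] by simp
    also have "\<dots> = diff_class (13 - (m - n))" using 3 mn by (intro diff_class_tr) auto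
    also have "13 - (m - n) = (n + 13 - m) mod 13" using 3 mn by simp
    finally show ?thesis .
  qed
qed

lemma geodesic_bij:
  assumes X: "geodesic X"
  shows "bij_betw X {..<13} UNIV"
proof -
  have ne: "X m \<noteq> X n" if mn: "m < n" "n < 13" for m n
  proof
    assume "X m = X n"
    then have "cl (X m) (X n) = 0" using cl_0 by blast
    moreover have "(n + 13 - m) mod 13 = n - m" using mn by (intro diff_mod_13) auto
    ultimately have "diff_class (n - m) = 0" using geodesic_cl[OF X, of m n] mn by simp
    then show False using mn by (simp add: diff_class_def split: if_splits)
  qed
  then have inj: "inj_on X {..<13}" by (intro linorder_inj_onI) auto
  have "card (X ` {..<13}) = CARD('a)" using inj n_eq params13 by (simp add: card_image)
  then have "X ` {..<13} = UNIV" by (intro card_subset_eq) auto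
  then show ?thesis using inj by (simp add: bij_betw_def)
qed

section \<open>The isomorphism onto the cyclotomic scheme\<close>

lemma iso_cyclotomic:
  fixes \<alpha> :: "'f::{finite,field}"
  assumes card: "CARD('f) = 13" and prim: "primitive_element \<alpha>"
  shows "scheme_iso d R 4 (cyclotomic_rel \<alpha> 4)"
proof -
  obtain X :: "nat \<Rightarrow> 'a" where X: "geodesic X"
    using ex_sequence unfolding geodesic_def by metis
  note bX = geodesic_bij[OF X] and bF = field13_of_nat_bij[OF card]
  note iff = field13_of_nat_eq_iff[OF card]
  define F :: "'a \<Rightarrow> 'f" where "F = of_nat \<circ> the_inv_into {..<13} X"
  have bijF: "bij F" unfolding F_def
    by (rule bij_betw_trans[OF bij_betw_the_inv_into[OF bX] bF])
  have FX: "F (X m) = of_nat m" if "m < 13" for m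
    using that bX by (simp add: F_def the_inv_into_f_f bij_betw_def)
  \<comment> \<open>\<open>cyclotomic_rel\<close> sorts a pair (s, t) by s - t, whereas
    \<open>diff_class\<close> takes the step t - s. Hence the argument (13 - q) mod 13, with q = 0
    sent to 0, and \<open>D\<close> is the negative of a fibre of \<open>diff_class\<close>:
    \<open>u\<close> goes with {4, 10, 12}.\<close>
  have image: "map_prod F F ` R i = {(s, t). s - t \<in> of_nat ` D}"
    if i: "i \<le> d" and D: "D \<subseteq> {..<13}" "\<And>q. q < 13 \<Longrightarrow> diff_class ((13 - q) mod 13) = i \<longleftrightarrow> q \<in> D" for i D
  proof -
    have key: "(F x, F y) \<in> map_prod F F ` R i \<longleftrightarrow> F x - F y \<in> of_nat ` D" for x y
    proof -
      obtain m where m: "m < 13" "x = X m" using bX unfolding bij_betw_def by (metis UNIV_I imageE lessThan_iff)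
      obtain n where n: "n < 13" "y = X n" using bX unfolding bij_betw_def by (metis UNIV_I imageE lessThan_iff)
      define q where "q = (m + 13 - n) mod 13"
      have q: "q < 13" by (simp add: q_def)
      have "F x = of_nat q + F y"
        unfolding m n FX[OF m(1)] FX[OF n(1)] of_nat_add[symmetric] iff q_def
        using n(1) by (simp add: mod_add_left_eq)
      then have "F x - F y \<in> of_nat ` D \<longleftrightarrow> (of_nat q :: 'f) \<in> of_nat ` D" by simp
      also have "\<dots> \<longleftrightarrow> q \<in> D"
      proof
        assume "(of_nat q :: 'f) \<in> of_nat ` D"
        then obtain q' where "q' \<in> D" "(of_nat q :: 'f) = of_nat q'" by blast
        then show "q \<in> D" using D(1) q by (auto simp: iff)
      qed blast
      also have "\<dots> \<longleftrightarrow> diff_class ((13 - q) mod 13) = i" using D(2)[OF q] by simp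
      also have "(13 - q) mod 13 = (n + 13 - m) mod 13"
      proof (cases "m < n")
        case True
        then have "q = m + 13 - n" using n by (simp add: q_def)
        moreover have "(n + 13 - m) mod 13 = n - m" using True n by (intro diff_mod_13) auto
        ultimately show ?thesis using True n(1) by simp
      next
        case False
        then have "q = m - n" unfolding q_def using m by (intro diff_mod_13) auto
        moreover have "13 - (m - n) = n + 13 - m" using False m(1) by linarith
        ultimately show ?thesis by simp
      qed
      also have "diff_class ((n + 13 - m) mod 13) = i \<longleftrightarrow> (x, y) \<in> R i"
        unfolding cl_eq_iff[OF i, symmetric] m(2) n(2) geodesic_cl[OF X m(1) n(1)] ..
      also have "\<dots> \<longleftrightarrow> (F x, F y) \<in> map_prod F F ` R i"
        using inj_image_mem_iff[OF prod.inj_map, of F F "(x, y)" "R i"] bijF by (simp add: bij_def)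
      finally show ?thesis by (rule sym)
    qed
    show ?thesis
    proof (rule set_eqI)
      fix st :: "'f \<times> 'f"
      obtain x y where "st = (F x, F y)" using bijF by (metis bij_pointE surj_pair)
      then show "st \<in> map_prod F F ` R i \<longleftrightarrow> st \<in> {(s, t). s - t \<in> of_nat ` D}" using key by simp
    qed
  qed
  have nonzero: "\<exists>j\<le>4. map_prod F F ` R i = cyclotomic_rel \<alpha> 4 j"
    if h: "i \<le> d" "D \<in> {{4, 10, 12}, {1, 3, 9}, {7, 8, 11}, {2, 5, 6}}"
      "\<And>q. q < 13 \<Longrightarrow> diff_class ((13 - q) mod 13) = i \<longleftrightarrow> q \<in> D" for i D
  proof -
    obtain j where j: "j \<in> {1..4}" "range (\<lambda>n::int. \<alpha> ^ j * (\<alpha> ^ 4) powi n) = of_nat ` D"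
      using field13_cosets[OF card prim h(2)] by blast
    have "D \<subseteq> {..<13}" using h(2) by auto
    then have "map_prod F F ` R i = {(s, t). s - t \<in> of_nat ` D}" using image[OF h(1) _ h(3)] by blast
    then have "map_prod F F ` R i = cyclotomic_rel \<alpha> 4 j"
      using j unfolding cyclotomic_rel_def by simp
    then show ?thesis using j(1) by auto
  qed
  have "\<exists>j\<le>4. map_prod F F ` R i = cyclotomic_rel \<alpha> 4 j" if "i \<le> d" for i
    using idx_cases[OF that]
  proof (elim disjE)
    assume "i = 0"
    moreover have "map_prod F F ` Id = Id"
    proof -
      have "map_prod F F ` Id = (\<lambda>x. (x, x)) ` range F" by (auto simp: Id_def image_iff)
      then show ?thesis using bijF by (auto simp: bij_def Id_def)
    qed
    ultimately show ?thesis by (intro exI[of _ 0]) (simp add: R_0 cyclotomic_rel_def)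
  next
    assume i: "i = u"
    show ?thesis
      by (rule nonzero[OF that, of "{4, 10, 12}"], simp, drule less_13_cases, elim disjE) (simp_all add: diff_class_def i)
  next
    assume i: "i = u'"
    show ?thesis
      by (rule nonzero[OF that, of "{1, 3, 9}"], simp, drule less_13_cases, elim disjE) (simp_all add: diff_class_def i)
  next
    assume i: "i = w"
    show ?thesis
      by (rule nonzero[OF that, of "{7, 8, 11}"], simp, drule less_13_cases, elim disjE) (simp_all add: diff_class_def i)
  next
    assume i: "i = w'"
    show ?thesis
      by (rule nonzero[OF that, of "{2, 5, 6}"], simp, drule less_13_cases, elim disjE) (simp_all add: diff_class_def i)
  qed
  then show ?thesis unfolding scheme_iso_def using bijF by blast
qed

end

theorem theorem1p1:
  fixes R :: "nat \<Rightarrow> 'a::finite rel" and d :: nat and \<alpha> :: "'f::{finite,field}"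
  assumes "commutative_scheme d R"
    and "d \<ge> 2"
    and "\<not> symmetric_rel d R 1"
    and "generates d R 1"
    and "complex_prod d R {1} {1} \<subseteq> {1, transp_idx d R 1, 2}"
    and "complex_prod d R {1} {transp_idx d R 1}
           \<subseteq> {0, 1, transp_idx d R 1, 2, transp_idx d R 2}"
    and "2 \<notin> {transp_idx d R 1, transp_idx d R 2}"
    and "valency d R 1 = valency d R 2"
    and "valency d R 2 > 1"
  shows "d = 4 \<and>
    (pseudocyclic d R \<longrightarrow>
      CARD('f) = 13 \<longrightarrow> primitive_element \<alpha> \<longrightarrow>
        scheme_iso d R 4 (cyclotomic_rel \<alpha> 4))"
proof -
  interpret narrow_scheme d R 1 2
  proof unfold_locales
    show "m \<in> {1, transp_idx d R 1, 2}" if "m \<le> d" "int_num d R 1 1 m \<noteq> 0" for m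
      using that assms(5) by (auto simp: complex_prod_def)
    show "m \<in> {0, 1, transp_idx d R 1, 2, transp_idx d R 2}"
      if "m \<le> d" "int_num d R 1 (transp_idx d R 1) m \<noteq> 0" for m
      using that assms(6) by (auto simp: complex_prod_def)
  qed (use assms in \<open>auto simp: symmetric_rel_def\<close>)
  have "scheme_iso d R 4 (cyclotomic_rel \<alpha> 4)"
    if "pseudocyclic d R" "CARD('f) = 13" "primitive_element \<alpha>"
  proof -
    interpret pseudocyclic_narrow_scheme d R 1 2
      by unfold_locales (rule that)
    show ?thesis using that(2,3) by (rule iso_cyclotomic)
  qed
  then show ?thesis using idx_imp_d[OF regular_params(1)] by blast
qed

end
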